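(* Let $k$ and $l$ be natural numbers satisfying $1\le l\le k-2$, and let $$\sigma=\frac{l+2}{l+1}\,2^{1-k}.$$ Then for every $\epsilon>0$ there exists a real number $X(k,\epsilon)$ such that, for all real numbers $\alpha_k$ and $\alpha_j$ $(0\le j\le l)$ and all real $X\ge X(k,\epsilon)$, one has $$\min_{\substack{0\le x,y\le X\\ (x,y)\ne(0,0)}}\left\|\alpha_k x^k+\alpha_l x^l y^{k-l}+\alpha_{l-1}x^{l-1}y^{k-l+1}+\cdots+\alpha_0 y^k\right\|<X^{-\sigma+\epsilon},$$ where the minimum is over integers $x,y$.
   Context: $\|\theta\|$ denotes the distance from the real number $\theta$ to the nearest integer. The threshold $X(k,\epsilon)$ depends at most on $k$ (hence possibly on $l$, which takes finitely many values) and $\epsilon$, and not on the coefficients $\alpha_j$. *)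

theory Defs
  imports "HOL-Analysis.Analysis"
begin

definition nearest_int_dist :: "real \<Rightarrow> real"
  where "nearest_int_dist \<theta> = infdist \<theta> \<int>"

text \<open>
  The coefficients \<open>\<alpha> j\<close> with \<open>j \<notin> {0..l} \<union> {k}\<close> are not used;
  for \<open>l < k\<close>, \<open>\<alpha> k\<close> is independent of \<open>\<alpha> 0, \<dots>, \<alpha> l\<close>.
\<close>

definition gap_form :: "nat \<Rightarrow> nat \<Rightarrow> (nat \<Rightarrow> real) \<Rightarrow> int \<Rightarrow> int \<Rightarrow> real"
  where "gap_form k l \<alpha> x y =
    \<alpha> k * of_int x ^ k + (\<Sum>j=0..l. \<alpha> j * of_int x ^ j * of_int y ^ (k - j))"

definition box_pairs :: "real \<Rightarrow> (int \<times> int) set"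
  where "box_pairs X =
    {(x, y). 0 \<le> x \<and> of_int x \<le> X \<and> 0 \<le> y \<and> of_int y \<le> X \<and> (x, y) \<noteq> (0, 0)}"

definition gap_exponent :: "nat \<Rightarrow> nat \<Rightarrow> real"
  where "gap_exponent k l = (real l + 2) / (real l + 1) * 2 powr (1 - real k)"

end

theory Submission
  imports Defs "HOL-Computational_Algebra.Polynomial" "HOL-Computational_Algebra.Primes"
begin

text \<open>
  Suppose that \<open>\<parallel>\<phi>(x, y)\<parallel> \<ge> 1/H\<close> throughout the box, where \<open>\<phi>\<close> is the given form. Then the exponential
  sums of \<open>h \<phi>(x, y)\<close> with \<open>1 \<le> h \<le> 2H\<close> are large on average. After \<open>l\<close> Weyl differencings in \<open>x\<close> they factor
  into a sum over \<open>x\<close> depending only on \<open>\<alpha>\<^sub>k\<close> and a sum over \<open>y\<close> depending only on \<open>\<alpha>\<^sub>l y\<^bsup>k-l\<^esup>\<close>. Cauchy's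
  inequality and Weyl's method for both factors save a total of \<open>X Z\<close> in the power \<open>2\<^bsup>k-1\<^esup>\<close>, which is a
  contradiction for \<open>Z = X\<^bsup>1/(l+1)\<^esup>\<close> (up to small powers of \<open>X\<close>), unless \<open>\<alpha>\<^sub>k\<close> has a rational approximation with
  denominator at most \<open>X\<close> or \<open>\<alpha>\<^sub>l\<close> has one with denominator \<open>q \<le> Z\<close>. In the first case some point \<open>(x, 0)\<close>
  makes \<open>\<phi>\<close> small. In the second case we substitute \<open>y = q y'\<close> with \<open>y' \<le> Y/Z\<close>, where \<open>Y\<close> bounds \<open>y\<close>: the term with
  \<open>\<alpha>\<^sub>l\<close> is then negligible modulo 1 and \<open>l\<close> drops to \<open>l - 1\<close>. The range of \<open>y\<close> is at least \<open>Z\<close> when only \<open>\<alpha>\<^sub>0\<close> is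
  left, and there an approximation of \<open>\<alpha>\<^sub>0\<close> gives a suitable point \<open>(0, y)\<close>.
\<close>

section \<open>Distance to the nearest integer and exponential sums\<close>

text \<open>The exponent records a balance. With \<open>l\<close> differencings in \<open>x\<close>
  and \<open>k - l - 1\<close> further ones in each factor, \<open>H\<close> occurs to the power
  2^(l + (k-l-1)) = 2^(k-1) and is compared with \<open>X Z\<close>. The size of \<open>Z\<close> is
  limited by the range of \<open>y\<close>: a product of differences vanishes for a proportion of
  order 1/P of the lists, where P is the current range, so the second factor can save at most about
  P. Each descent divides this range by \<open>Z\<close>, and after \<open>l\<close> descents X /
  Z^l must still be at least \<open>Z\<close>; this fixes Z = X^(1/(l+1)). The descent is forced
  because \<alpha>_l is arbitrary: near a fraction with small denominator the sum over
  \<open>y\<close> saves nothing. As only \<open>y\<close> is rescaled, \<alpha>_k and the range of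
  \<open>x\<close> are unchanged, and the saving of about \<open>X\<close> in the first factor is
  available at every stage. Removing a term uses half of the permitted distance, so each descent
  replaces \<open>H\<close> by \<open>2 H\<close>. A factor X^(\<delta>/4) pays for this, for the
  factorials created by differencing and for the constants; the divisor bounds are paid for in the
  same way.\<close>

lemma nearest_int_dist_le: "nearest_int_dist t \<le> \<bar>t - of_int n\<bar>"
  unfolding nearest_int_dist_def
  using infdist_le[of "of_int n :: real" \<int> t] by (simp add: dist_real_def)

lemma nearest_int_dist_round: "nearest_int_dist t = \<bar>t - of_int (round t)\<bar>"
proof (rule antisym)
  show "\<bar>t - of_int (round t)\<bar> \<le> nearest_int_dist t"
    unfolding nearest_int_dist_def infdist_def
    by (auto intro!: cINF_greatest round_diff_minimal simp: dist_real_def Ints_def)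
qed (rule nearest_int_dist_le)

lemma nearest_int_dist_nonneg [simp]: "0 \<le> nearest_int_dist t"
  by (simp add: nearest_int_dist_def infdist_nonneg)

lemma nearest_int_dist_minus [simp]: "nearest_int_dist (- t) = nearest_int_dist t"
proof -
  have "nearest_int_dist (- s) \<le> nearest_int_dist s" for s
    using nearest_int_dist_le[of "- s" "- round s"] by (simp add: nearest_int_dist_round)
  from this[of t] this[of "- t"] show ?thesis by simp
qed

lemma nearest_int_dist_triangle: "nearest_int_dist (s + t) \<le> nearest_int_dist s + nearest_int_dist t"
  using nearest_int_dist_le[of "s + t" "round s + round t"] by (simp add: nearest_int_dist_round)

lemma nearest_int_dist_add_int [simp]: "nearest_int_dist (t + of_int n) = nearest_int_dist t"
proof -
  have "nearest_int_dist (s + of_int m) \<le> nearest_int_dist s" for s m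
    using nearest_int_dist_le[of "s + of_int m" "round s + m"] by (simp add: nearest_int_dist_round)
  from this[of t n] this[of "t + of_int n" "- n"] show ?thesis by simp
qed

lemma nearest_int_dist_mult: "nearest_int_dist (of_int n * t) \<le> \<bar>of_int n\<bar> * nearest_int_dist t"
  using nearest_int_dist_le[of "of_int n * t" "n * round t"]
  by (simp add: nearest_int_dist_round abs_mult flip: right_diff_distrib)

lemma nearest_int_dist_small:
  assumes "\<bar>t\<bar> \<le> 1/2" shows "nearest_int_dist t = \<bar>t\<bar>"
proof (rule antisym)
  show "nearest_int_dist t \<le> \<bar>t\<bar>" using nearest_int_dist_le[of t 0] by simp
  show "\<bar>t\<bar> \<le> nearest_int_dist t"
  proof (cases "round t = 0")
    case False
    hence "1 \<le> \<bar>real_of_int (round t)\<bar>" by linarith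
    with assms show ?thesis unfolding nearest_int_dist_round by linarith
  qed (simp add: nearest_int_dist_round)
qed

section \<open>Additive characters and geometric sums\<close>

definition unit_exp :: "real \<Rightarrow> complex" where "unit_exp t = cis (2 * pi * t)"

lemma unit_exp_add: "unit_exp (s + t) = unit_exp s * unit_exp t"
  by (simp add: unit_exp_def cis_mult ring_distribs)

lemma unit_exp_0 [simp]: "unit_exp 0 = 1"
  by (simp add: unit_exp_def)

lemma norm_unit_exp [simp]: "norm (unit_exp t) = 1"
  by (simp add: unit_exp_def)

lemma cnj_unit_exp: "cnj (unit_exp t) = unit_exp (- t)"
  by (simp add: unit_exp_def cis_cnj)

lemma unit_exp_int [simp]: "unit_exp (of_int n) = 1"
  by (simp add: unit_exp_def cis_multiple_2pi)

lemma unit_exp_diff: "unit_exp (s - t) = unit_exp s * cnj (unit_exp t)"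
  using unit_exp_add[of s "- t"] by (simp add: cnj_unit_exp)

text \<open>Jordan's inequality: the concave sine lies above its chord on
  \<open>[0, pi/2]\<close>.\<close>

lemma sin_pi_ge:
  assumes "0 \<le> t" "t \<le> 1/2" shows "2 * t \<le> sin (pi * t)"
proof -
  have "concave_on {0..pi/2} sin"
    unfolding concave_on_def
    by (rule f''_ge0_imp_convex[where f' = "\<lambda>x. - cos x" and f'' = sin])
       (auto intro!: derivative_eq_intros sin_ge_zero)
  hence "(1 - 2*t) * sin 0 + (2*t) * sin (pi/2) \<le> sin ((1 - 2*t) *\<^sub>R 0 + (2*t) *\<^sub>R (pi/2))"
    by (rule concave_onD) (use assms in auto)
  thus ?thesis by (simp add: mult_ac)
qed

text \<open>The left side is periodic, and for the residue \<open>u\<close> with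
  \<open>|u| <= 1/2\<close> the norm is \<open>2 |sin (pi u)|\<close>, which is in the range of the
  chord bound for sine.\<close>

lemma norm_one_minus_unit_exp: "4 * nearest_int_dist t \<le> norm (1 - unit_exp t)"
proof -
  define u where "u = t - of_int (round t)"
  have u: "\<bar>u\<bar> \<le> 1/2" and d: "nearest_int_dist t = \<bar>u\<bar>"
    using of_int_round_abs_le[of t] by (simp_all add: u_def abs_minus_commute nearest_int_dist_round)
  have "unit_exp t = unit_exp u"
    using unit_exp_add[of u "of_int (round t)"] by (simp add: u_def)
  moreover have "norm (1 - unit_exp u) = 2 * \<bar>sin (pi * u)\<bar>"
  proof -
    have "norm (1 - unit_exp u) ^ 2 = (1 - cos (2 * (pi * u)))^2 + (sin (2 * (pi * u)))^2"
      by (simp add: cmod_def unit_exp_def mult.assoc)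
    also have "\<dots> = (2 * \<bar>sin (pi * u)\<bar>)^2"
    proof -
      have "(sin (pi*u))^2 + (cos (pi*u))^2 = 1" by simp
      thus ?thesis unfolding cos_double_sin sin_double power2_abs power_mult_distrib by algebra
    qed
    finally show ?thesis by (rule power2_eq_imp_eq) auto
  qed
  moreover have "2 * \<bar>u\<bar> \<le> \<bar>sin (pi * u)\<bar>"
    using sin_pi_ge[of "\<bar>u\<bar>"] u by (cases "u \<ge> 0") (auto simp: abs_if split: if_splits)
  ultimately show ?thesis using d by simp
qed

text \<open>Multiplication by \<open>1 - unit_exp t\<close> telescopes the sum to two terms of
  modulus 1. The product form avoids dividing by a distance that may be 0.\<close>

lemma unit_exp_sum_bound:
  fixes a b :: int
  shows "norm (\<Sum>x\<in>{a..b}. unit_exp (t * of_int x + c)) * nearest_int_dist t \<le> 1/2"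
proof (cases "a \<le> b")
  case True
  define f where "f x = unit_exp (t * of_int x + c)" for x :: int
  have "(\<Sum>x\<in>{a..b}. f x) * (1 - unit_exp t) = f a - f (b + 1)"
    using True
  proof (induction rule: int_ge_induct)
    case base
    show ?case by (simp add: f_def algebra_simps flip: unit_exp_add)
  next
    case (step b)
    hence "{a..b+1} = insert (b+1) {a..b}" by auto
    moreover have "f (b + 1) * unit_exp t = f (b + 1 + 1)"
      by (simp add: f_def algebra_simps flip: unit_exp_add)
    ultimately show ?case using step by (simp add: distrib_right right_diff_distrib)
  qed
  hence "norm (\<Sum>x\<in>{a..b}. f x) * norm (1 - unit_exp t) = norm (f a - f (b + 1))"
    by (metis norm_mult)
  also have "\<dots> \<le> 2"
    using norm_triangle_ineq4[of "f a" "f (b+1)"] by (simp add: f_def)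
  finally have "norm (\<Sum>x\<in>{a..b}. f x) * norm (1 - unit_exp t) \<le> 2" .
  moreover have "norm (\<Sum>x\<in>{a..b}. f x) * (4 * nearest_int_dist t) \<le> norm (\<Sum>x\<in>{a..b}. f x) * norm (1 - unit_exp t)"
    by (rule mult_left_mono[OF norm_one_minus_unit_exp]) simp
  ultimately show ?thesis by (simp add: f_def)
qed simp

text \<open>This is \<open>min Y (1/\<parallel>t\<parallel>)\<close>, written so that it equals \<open>Y\<close> (and not \<open>0\<close>) for integral \<open>t\<close>.\<close>

definition recip_weight :: "real \<Rightarrow> real \<Rightarrow> real"
  where "recip_weight Y t = 1 / max (1 / Y) (nearest_int_dist t)"

lemma unit_exp_sum_le_weight:
  fixes a b :: int
  assumes "real (card {a..b}) \<le> Y" "Y > 0"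
  shows "norm (\<Sum>x\<in>{a..b}. unit_exp (t * of_int x + c)) \<le> recip_weight Y t"
proof -
  let ?S = "norm (\<Sum>x\<in>{a..b}. unit_exp (t * of_int x + c))"
  have "?S \<le> Y"
    using norm_sum[of "\<lambda>x. unit_exp (t * of_int x + c)" "{a..b}"] assms by simp
  hence "?S * max (1/Y) (nearest_int_dist t) \<le> 1"
    using unit_exp_sum_bound[of t c a b] assms(2) by (auto simp: max_def field_simps)
  thus ?thesis using assms(2) by (simp add: recip_weight_def field_simps less_max_iff_disj)
qed

lemma recip_weight_nonneg: "Y > 0 \<Longrightarrow> recip_weight Y t \<ge> 0"
  by (simp add: recip_weight_def le_max_iff_disj)

lemma recip_weight_le: "Y > 0 \<Longrightarrow> recip_weight Y t \<le> Y"
  using frac_le[of 1 1 "1 / Y" "max (1 / Y) (nearest_int_dist t)"] by (simp add: recip_weight_def)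

lemma recip_weight_le_inverse: "Y > 0 \<Longrightarrow> 0 < d \<Longrightarrow> d \<le> nearest_int_dist t \<Longrightarrow> recip_weight Y t \<le> 1 / d"
  using frac_le[of 1 1 d "max (1 / Y) (nearest_int_dist t)"] by (simp add: recip_weight_def)

lemma recip_weight_abs: "recip_weight Y (t * \<bar>s\<bar>) = recip_weight Y (t * s)"
  by (simp add: recip_weight_def abs_if)

section \<open>Mean squares of trigonometric polynomials and the Fejer kernel\<close>

lemma sum_trig_poly_square:
  fixes c :: "int \<Rightarrow> real" and \<theta> :: "'a \<Rightarrow> real" and m :: nat and A :: "'a set"
  defines "S \<equiv> \<lambda>t::int. norm (\<Sum>n\<in>A. unit_exp (of_int t * \<theta> n))"
  assumes J: "J \<subseteq> {- int m..int m}"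
  shows "\<bar>(\<Sum>n\<in>A. (norm (\<Sum>h\<in>J. c h * unit_exp (of_int h * \<theta> n)))\<^sup>2) - real (card A) * (\<Sum>h\<in>J. (c h)\<^sup>2)\<bar>
           \<le> (\<Sum>h\<in>J. (c h)\<^sup>2) * (2 * (\<Sum>t\<in>{1..2 * int m}. S t))"
proof -
  define T where "T t = (\<Sum>n\<in>A. unit_exp (of_int t * \<theta> n))" for t :: int
  have S: "S t = norm (T t)" for t by (simp add: S_def T_def)
  have finJ: "finite J" using J by (rule finite_subset) simp
  have sym: "S (- t) = S t" for t
  proof -
    have "T (- t) = cnj (T t)" by (simp add: T_def cnj_unit_exp)
    thus ?thesis by (simp add: S)
  qed
  have "complex_of_real (\<Sum>n\<in>A. (norm (\<Sum>h\<in>J. c h * unit_exp (of_int h * \<theta> n)))\<^sup>2)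
      = (\<Sum>n\<in>A. \<Sum>h\<in>J. \<Sum>h'\<in>J. c h * c h' * unit_exp (of_int (h - h') * \<theta> n))"
    by (simp add: complex_norm_square sum_product left_diff_distrib unit_exp_diff mult.assoc mult.left_commute del: of_real_power)
  also have "\<dots> = (\<Sum>h\<in>J. \<Sum>h'\<in>J. c h * c h' * T (h - h'))"
    unfolding T_def sum_distrib_left
    by (subst sum.swap, rule sum.cong[OF refl], subst sum.swap) simp
  also have "\<dots> = (\<Sum>h\<in>J. c h * c h * T 0) + (\<Sum>h\<in>J. \<Sum>h'\<in>J-{h}. c h * c h' * T (h - h'))"
    unfolding sum.distrib[symmetric] using finJ by (intro sum.cong refl) (simp add: sum.remove)
  also have "(\<Sum>h\<in>J. c h * c h * T 0) = complex_of_real (real (card A) * (\<Sum>h\<in>J. (c h)\<^sup>2))"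
    by (simp add: T_def sum_distrib_left power2_eq_square mult_ac)
  finally have eq: "complex_of_real ((\<Sum>n\<in>A. (norm (\<Sum>h\<in>J. c h * unit_exp (of_int h * \<theta> n)))\<^sup>2) - real (card A) * (\<Sum>h\<in>J. (c h)\<^sup>2))
     = (\<Sum>h\<in>J. \<Sum>h'\<in>J-{h}. c h * c h' * T (h - h'))"
    by simp
  \<comment> \<open>For fixed \<open>h\<close> the differences \<open>h - h'\<close> are distinct,
    nonzero and at most \<open>2 m\<close> in absolute value, so each \<open>t\<close> of either
    sign is hit at most once; \<open>S\<close> is even, whence the factor 2.\<close>
  have off: "(\<Sum>h'\<in>J-{h}. S (h - h')) \<le> 2 * (\<Sum>t\<in>{1..2 * int m}. S t)" if "h \<in> J" for h
  proof -
    have "(\<Sum>h'\<in>J-{h}. S (h - h')) = (\<Sum>t\<in>(\<lambda>h'. h - h') ` (J-{h}). S t)"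
      by (subst sum.reindex) (auto simp: inj_on_def)
    also have "\<dots> \<le> (\<Sum>t\<in>{1..2 * int m} \<union> uminus ` {1..2 * int m}. S t)"
    proof (rule sum_mono2)
      show "(\<lambda>h'. h - h') ` (J-{h}) \<subseteq> {1..2 * int m} \<union> uminus ` {1..2 * int m}"
      proof
        fix t assume "t \<in> (\<lambda>h'. h - h') ` (J-{h})"
        then obtain h' where "h' \<in> J" "h' \<noteq> h" "t = h - h'" by auto
        moreover from this J that have "- int m \<le> h" "h \<le> int m" "- int m \<le> h'" "h' \<le> int m" by auto
        ultimately have "\<bar>t\<bar> \<in> {1..2 * int m}" by auto
        thus "t \<in> {1..2 * int m} \<union> uminus ` {1..2 * int m}"
          by (cases "t \<ge> 0") (auto intro!: image_eqI[of t uminus "- t"])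
      qed
    qed (auto simp: S)
    also have "\<dots> \<le> (\<Sum>t\<in>{1..2 * int m}. S t) + (\<Sum>t\<in>uminus ` {1..2 * int m}. S t)"
      by (subst sum.union_inter[symmetric]) (auto simp: S sum_nonneg)
    also have "(\<Sum>t\<in>uminus ` {1..2 * int m}. S t) = (\<Sum>t\<in>{1..2 * int m}. S t)"
      by (subst sum.reindex) (auto simp: sym)
    finally show ?thesis by simp
  qed
  have "\<bar>(\<Sum>n\<in>A. (norm (\<Sum>h\<in>J. c h * unit_exp (of_int h * \<theta> n)))\<^sup>2) - real (card A) * (\<Sum>h\<in>J. (c h)\<^sup>2)\<bar>
      = norm (\<Sum>h\<in>J. \<Sum>h'\<in>J-{h}. c h * c h' * T (h - h'))"
    unfolding eq[symmetric] norm_of_real ..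
  also have "\<dots> \<le> (\<Sum>h\<in>J. \<Sum>h'\<in>J-{h}. \<bar>c h * c h'\<bar> * S (h - h'))"
    by (intro order_trans[OF norm_sum] sum_mono) (simp add: norm_mult S abs_mult)
  \<comment> \<open>Schur's test: after splitting \<open>|c h * c h'|\<close> symmetrically, only
    row sums of \<open>S (h - h')\<close> remain to be bounded.\<close>
  also have "\<dots> \<le> (\<Sum>h\<in>J. \<Sum>h'\<in>J-{h}. ((c h)\<^sup>2 / 2 + (c h')\<^sup>2 / 2) * S (h - h'))"
  proof (intro sum_mono mult_right_mono)
    fix h h'
    show "\<bar>c h * c h'\<bar> \<le> (c h)\<^sup>2 / 2 + (c h')\<^sup>2 / 2"
      using sum_squares_bound[of "\<bar>c h\<bar>" "\<bar>c h'\<bar>"] by (simp add: abs_mult)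
  qed (simp add: S)
  also have "\<dots> = (\<Sum>h\<in>J. \<Sum>h'\<in>J-{h}. (c h)\<^sup>2 / 2 * S (h - h')) + (\<Sum>h\<in>J. \<Sum>h'\<in>J-{h}. (c h')\<^sup>2 / 2 * S (h - h'))"
    by (simp add: ring_distribs sum.distrib)
  also have "(\<Sum>h\<in>J. \<Sum>h'\<in>J-{h}. (c h')\<^sup>2 / 2 * S (h - h')) = (\<Sum>h\<in>J. \<Sum>h'\<in>J. if h' \<noteq> h then (c h')\<^sup>2 / 2 * S (h - h') else 0)"
    using finJ by (intro sum.cong refl sum.mono_neutral_cong_left) auto
  also have "\<dots> = (\<Sum>h'\<in>J. \<Sum>h\<in>J. if h' \<noteq> h then (c h')\<^sup>2 / 2 * S (h - h') else 0)"
    by (rule sum.swap)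
  also have "\<dots> = (\<Sum>h\<in>J. \<Sum>h'\<in>J-{h}. (c h)\<^sup>2 / 2 * S (h - h'))"
    using finJ sym[of "_ - _"] by (intro sum.cong refl sum.mono_neutral_cong_right) auto
  also have "(\<Sum>h\<in>J. \<Sum>h'\<in>J-{h}. (c h)\<^sup>2 / 2 * S (h - h')) + (\<Sum>h\<in>J. \<Sum>h'\<in>J-{h}. (c h)\<^sup>2 / 2 * S (h - h'))
      = (\<Sum>h\<in>J. (c h)\<^sup>2 * (\<Sum>h'\<in>J-{h}. S (h - h')))"
    unfolding sum.distrib[symmetric] sum_distrib_left by (simp add: field_simps)
  also have "\<dots> \<le> (\<Sum>h\<in>J. (c h)\<^sup>2 * (2 * (\<Sum>t\<in>{1..2 * int m}. S t)))"
    by (intro sum_mono mult_left_mono off) auto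
  finally show ?thesis by (simp add: sum_distrib_right)
qed


text \<open>Coefficients of the Fejer kernel of order \<open>m\<close>, without the usual factor
  \<open>1 / m\<close>.\<close>

definition triangle_weight :: "nat \<Rightarrow> int \<Rightarrow> real"
  where "triangle_weight m h = max 0 (real m - \<bar>of_int h\<bar>)"

text \<open>Summation by parts: the weight has slope 1 up to 0 and slope -1 afterwards, and it
  vanishes at both ends, so shifting the index leaves no boundary terms.\<close>

lemma triangle_sum_diff:
  "(1 - unit_exp t) * (\<Sum>h\<in>{-int m..int m}. triangle_weight m h * unit_exp (of_int h * t))
     = (\<Sum>h\<in>{-int m+1..int m}. (if h \<le> 0 then 1 else - 1 :: real) * unit_exp (of_int h * t))"
proof -
  define f where "f h = triangle_weight m h * unit_exp (of_int h * t)" for h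
  define g where "g h = triangle_weight m (h - 1) * unit_exp (of_int h * t)" for h
  have g_Suc: "g (h + 1) = unit_exp t * f h" for h
    unfolding f_def g_def of_int_add distrib_right unit_exp_add by simp
  have ends: "triangle_weight m (- int m) = 0" "triangle_weight m (int m) = 0"
    by (simp_all add: triangle_weight_def)
  have "(1 - unit_exp t) * (\<Sum>h\<in>{-int m..int m}. f h)
      = (\<Sum>h\<in>{-int m..int m}. f h) - (\<Sum>h\<in>{-int m..int m}. g (h + 1))"
    by (simp add: left_diff_distrib sum_distrib_left g_Suc sum_subtractf)
  moreover have "(\<Sum>h\<in>{-int m..int m}. f h) = (\<Sum>h\<in>{-int m+1..int m}. f h)"
  proof (rule sum.mono_neutral_right)
    show "\<forall>h\<in>{-int m..int m} - {-int m+1..int m}. f h = 0"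
    proof
      fix h assume "h \<in> {-int m..int m} - {-int m+1..int m}"
      hence "h = - int m" by auto
      thus "f h = 0" by (simp add: f_def ends)
    qed
  qed auto
  moreover have "(\<Sum>h\<in>{-int m..int m}. g (h + 1)) = (\<Sum>h\<in>{-int m+1..int m+1}. g h)"
    by (rule sum.reindex_bij_witness[of _ "\<lambda>h. h - 1" "\<lambda>h. h + 1"]) auto
  moreover have "(\<Sum>h\<in>{-int m+1..int m+1}. g h) = (\<Sum>h\<in>{-int m+1..int m}. g h)"
  proof (rule sum.mono_neutral_right)
    show "\<forall>h\<in>{-int m+1..int m+1} - {-int m+1..int m}. g h = 0"
    proof
      fix h assume "h \<in> {-int m+1..int m+1} - {-int m+1..int m}"
      hence "h = int m + 1" by auto
      thus "g h = 0" by (simp add: g_def ends)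
    qed
  qed auto
  moreover have "(\<Sum>h\<in>{-int m+1..int m}. f h) - (\<Sum>h\<in>{-int m+1..int m}. g h)
     = (\<Sum>h\<in>{-int m+1..int m}. (if h \<le> 0 then 1 else - 1 :: real) * unit_exp (of_int h * t))"
    unfolding sum_subtractf[symmetric]
  proof (rule sum.cong[OF refl])
    fix h assume h: "h \<in> {- int m + 1..int m}"
    hence "h \<le> int m" "- int m + 1 \<le> h" by simp_all
    hence "real_of_int h \<le> real m" "- real m + 1 \<le> real_of_int h" by linarith+
    moreover have "h \<le> 0 \<or> 1 \<le> real_of_int h" by linarith
    ultimately have tw: "triangle_weight m h - triangle_weight m (h - 1) = (if h \<le> 0 then 1 else - 1)"
      by (auto simp: triangle_weight_def max_def abs_if)
    show "f h - g h = (if h \<le> 0 then 1 else - 1 :: real) * unit_exp (of_int h * t)"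
      unfolding tw[symmetric] f_def g_def by (simp add: left_diff_distrib)
  qed
  ultimately show ?thesis unfolding f_def[symmetric] by simp
qed

text \<open>The middle half suffices: at least \<open>m\<close> integers satisfy
  \<open>|h| <= m div 2\<close>, and each of them has weight at least \<open>m / 2\<close>.\<close>

lemma sum_triangle_square: "real m ^ 3 / 4 \<le> (\<Sum>h\<in>{-int m..int m}. (triangle_weight m h)\<^sup>2)"
proof -
  define r where "r = int (m div 2)"
  have "2 * r \<le> int m" "int m \<le> 2 * r + 1" and r0: "r \<ge> 0" by (simp_all add: r_def)
  hence r: "2 * real_of_int r \<le> real m" "real m \<le> 2 * real_of_int r + 1" by linarith+
  have "real m ^ 3 / 4 = real m * (real m / 2)\<^sup>2" by (simp add: power2_eq_square power3_eq_cube)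
  also have "\<dots> \<le> real (card {-r..r}) * (real m / 2)\<^sup>2"
    using r r0 by (intro mult_right_mono) auto
  also have "\<dots> = (\<Sum>h\<in>{-r..r}. (real m / 2)\<^sup>2)" by simp
  also have "\<dots> \<le> (\<Sum>h\<in>{-r..r}. (triangle_weight m h)\<^sup>2)"
  proof (intro sum_mono power_mono)
    fix h assume "h \<in> {-r..r}"
    hence "\<bar>h\<bar> \<le> r" by auto
    hence "\<bar>real_of_int h\<bar> \<le> real_of_int r" by (metis of_int_abs of_int_le_iff)
    thus "real m / 2 \<le> triangle_weight m h" using r unfolding triangle_weight_def by linarith
  qed simp
  also have "\<dots> \<le> (\<Sum>h\<in>{-int m..int m}. (triangle_weight m h)\<^sup>2)"
    by (rule sum_mono2) (auto simp: r_def)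
  finally show ?thesis .
qed

text \<open>
  The kernel \<open>K(t) = \<Sum> (m - \<bar>h\<bar>) e(h t)\<close> is concentrated near the integers,
  since \<open>(1 - e(t)) K(t)\<close> has coefficients \<open>\<plusminus>1\<close>. If all points are far from the
  integers, the two mean squares can only be compatible if some \<open>S(t)\<close> is large.
\<close>

lemma exponential_sums_detect_gap:
  fixes \<theta> :: "'a \<Rightarrow> real" and H :: nat and A :: "'a set"
  assumes H: "H \<ge> 1" and far: "\<And>n. n \<in> A \<Longrightarrow> 1 / real H \<le> nearest_int_dist (\<theta> n)"
  shows "real (card A) \<le> 6 * (\<Sum>t\<in>{1..2 * int H}. norm (\<Sum>n\<in>A. unit_exp (of_int t * \<theta> n)))"
proof -
  define \<Sigma> where "\<Sigma> = (\<Sum>t\<in>{1..2 * int H}. norm (\<Sum>n\<in>A. unit_exp (of_int t * \<theta> n)))"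
  define K where "K n = (\<Sum>h\<in>{-int H..int H}. triangle_weight H h * unit_exp (of_int h * \<theta> n))" for n
  define L where "L n = (\<Sum>h\<in>{-int H+1..int H}. (if h \<le> 0 then 1 else - 1 :: real) * unit_exp (of_int h * \<theta> n))" for n
  define Q where "Q = (\<Sum>h\<in>{-int H..int H}. (triangle_weight H h)\<^sup>2)"
  have Q: "real H ^ 3 / 4 \<le> Q" unfolding Q_def by (rule sum_triangle_square)
  have "(\<Sum>n\<in>A. (norm (K n))\<^sup>2) \<ge> real (card A) * Q - Q * (2 * \<Sigma>)"
    using sum_trig_poly_square[of "{-int H..int H}" H "triangle_weight H" \<theta> A]
    unfolding K_def[symmetric] Q_def[symmetric] \<Sigma>_def[symmetric] using abs_le_iff by (smt (verit) subset_refl)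
  moreover have "(\<Sum>n\<in>A. (norm (L n))\<^sup>2) \<le> real (card A) * (2 * real H) + 2 * real H * (2 * \<Sigma>)"
  proof -
    have "(\<Sum>h\<in>{-int H+1..int H}. (if h \<le> 0 then 1 else - 1 :: real)\<^sup>2) = (\<Sum>h\<in>{-int H+1..int H}. 1)"
      by (intro sum.cong) auto
    also have "\<dots> = 2 * real H" by simp
    finally have sq: "(\<Sum>h\<in>{-int H+1..int H}. (if h \<le> 0 then 1 else - 1 :: real)\<^sup>2) = 2 * real H" .
    have "{-int H+1..int H} \<subseteq> {-int H..int H}" by auto
    from sum_trig_poly_square[OF this, of "\<lambda>h. if h \<le> 0 then 1 else - 1" \<theta> A]
    show ?thesis unfolding L_def[symmetric] \<Sigma>_def[symmetric] sq by linarith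
  qed
  moreover have "(16 / (real H)\<^sup>2) * (\<Sum>n\<in>A. (norm (K n))\<^sup>2) \<le> (\<Sum>n\<in>A. (norm (L n))\<^sup>2)"
    unfolding sum_distrib_left
  proof (rule sum_mono)
    fix n assume "n \<in> A"
    have "4 / real H \<le> norm (1 - unit_exp (\<theta> n))"
      using norm_one_minus_unit_exp[of "\<theta> n"] far[OF \<open>n \<in> A\<close>] by simp
    hence "(4 / real H * norm (K n))\<^sup>2 \<le> (norm (1 - unit_exp (\<theta> n)) * norm (K n))\<^sup>2"
      by (intro power_mono mult_right_mono) auto
    also have "norm (1 - unit_exp (\<theta> n)) * norm (K n) = norm (L n)"
      unfolding norm_mult[symmetric] K_def L_def by (subst triangle_sum_diff) simp
    finally show "16 / (real H)\<^sup>2 * (norm (K n))\<^sup>2 \<le> (norm (L n))\<^sup>2"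
      by (simp add: power_mult_distrib power_divide)
  qed
  ultimately have main: "(16 / (real H)\<^sup>2) * (Q * (real (card A) - 2 * \<Sigma>)) \<le> 2 * real H * (real (card A) + 2 * \<Sigma>)"
  proof -
    assume 1: "(\<Sum>n\<in>A. (norm (K n))\<^sup>2) \<ge> real (card A) * Q - Q * (2 * \<Sigma>)"
      and 2: "(\<Sum>n\<in>A. (norm (L n))\<^sup>2) \<le> real (card A) * (2 * real H) + 2 * real H * (2 * \<Sigma>)"
      and 3: "(16 / (real H)\<^sup>2) * (\<Sum>n\<in>A. (norm (K n))\<^sup>2) \<le> (\<Sum>n\<in>A. (norm (L n))\<^sup>2)"
    have "(16 / (real H)\<^sup>2) * (Q * (real (card A) - 2 * \<Sigma>)) \<le> (16 / (real H)\<^sup>2) * (\<Sum>n\<in>A. (norm (K n))\<^sup>2)"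
      using 1 by (intro mult_left_mono) (auto simp: right_diff_distrib mult.commute)
    also note 3
    also note 2
    finally show ?thesis by (simp add: distrib_left mult.commute)
  qed
  have "\<Sigma> \<ge> 0" by (simp add: \<Sigma>_def sum_nonneg)
  \<comment> \<open>\<open>16 / H^2\<close> times \<open>Q >= H^3 / 4\<close> gives
    \<open>4 H\<close> on the left of \<open>main\<close> against \<open>2 H\<close> on the right.
    This factor two makes the two diagonal terms incompatible: with c = \<open>card A\<close> and s
    = \<open>\<Sigma>\<close>, the inequality 2 (c - 2 s) <= c + 2 s means c <= 6 s.\<close>
  have "real (card A) \<le> 6 * \<Sigma>"
  proof (cases "real (card A) \<ge> 2 * \<Sigma>")
    case True
    have "4 * real H = (16 / (real H)\<^sup>2) * (real H ^ 3 / 4)" using H by (simp add: power2_eq_square power3_eq_cube)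
    also have "\<dots> \<le> (16 / (real H)\<^sup>2) * Q" using Q by (intro mult_left_mono) auto
    finally have "4 * real H * (real (card A) - 2 * \<Sigma>) \<le> (16 / (real H)\<^sup>2) * Q * (real (card A) - 2 * \<Sigma>)"
      using True by (intro mult_right_mono) auto
    with main have "2 * real H * (2 * (real (card A) - 2 * \<Sigma>)) \<le> 2 * real H * (real (card A) + 2 * \<Sigma>)"
      by (simp only: mult.assoc)
    hence "2 * (real (card A) - 2 * \<Sigma>) \<le> real (card A) + 2 * \<Sigma>" using H by simp
    thus ?thesis by simp
  qed (use \<open>\<Sigma> \<ge> 0\<close> in simp)
  thus ?thesis by (simp add: \<Sigma>_def)
qed

section \<open>Weyl differencing\<close>

text \<open>Normalised sums, so that iterating Cauchy's inequality produces no powers of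
  cardinalities.\<close>

definition avg :: "'a set \<Rightarrow> ('a \<Rightarrow> real) \<Rightarrow> real"
  where "avg A f = (\<Sum>x\<in>A. f x) / real (card A)"

lemma avg_mono: "(\<And>x. x \<in> A \<Longrightarrow> f x \<le> g x) \<Longrightarrow> avg A f \<le> avg A g"
  by (simp add: avg_def divide_right_mono sum_mono)

lemma avg_cong: "(\<And>x. x \<in> A \<Longrightarrow> f x = g x) \<Longrightarrow> avg A f = avg A g"
  by (simp add: avg_def)

lemma avg_nonneg: "(\<And>x. x \<in> A \<Longrightarrow> 0 \<le> f x) \<Longrightarrow> 0 \<le> avg A f"
  by (simp add: avg_def sum_nonneg)

lemma avg_cmult: "avg A (\<lambda>x. c * f x) = c * avg A f"
  by (simp add: avg_def sum_distrib_left)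

lemma avg_mult_square_le:
  "(avg A (\<lambda>x. f x * g x))\<^sup>2 \<le> avg A (\<lambda>x. (f x)\<^sup>2) * avg A (\<lambda>x. (g x)\<^sup>2)"
  using divide_right_mono[OF Cauchy_Schwarz_ineq_sum[of f g A], of "(real (card A))\<^sup>2"]
  by (simp add: avg_def power_divide power2_eq_square)

lemma avg_square_le: "(avg A f)\<^sup>2 \<le> avg A (\<lambda>x. (f x)\<^sup>2)"
proof (cases "card A = 0")
  case False
  hence "avg A (\<lambda>x. 1\<^sup>2) = 1" by (simp add: avg_def)
  thus ?thesis using avg_mult_square_le[of A f "\<lambda>_. 1"] by simp
qed (simp add: avg_def)

lemma avg_power_le:
  assumes "\<And>x. x \<in> A \<Longrightarrow> 0 \<le> f x"
  shows "avg A f ^ (2 ^ n) \<le> avg A (\<lambda>x. f x ^ (2 ^ n))"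
  using assms
proof (induction n arbitrary: f)
  case (Suc n)
  have "avg A f ^ (2 ^ Suc n) = ((avg A f)\<^sup>2) ^ (2 ^ n)" by (simp add: power_mult)
  also have "\<dots> \<le> avg A (\<lambda>x. (f x)\<^sup>2) ^ (2 ^ n)"
    by (intro power_mono avg_square_le) simp
  also have "\<dots> \<le> avg A (\<lambda>x. ((f x)\<^sup>2) ^ (2 ^ n))" by (rule Suc.IH) simp
  finally show ?case by (simp add: power_mult)
qed simp

text \<open>One application of Cauchy's inequality separates the factors, and the remaining
  \<open>n - 1\<close> squarings act on each average by itself; \<open>n >= 1\<close> supplies that
  one application.\<close>

lemma avg_mult_power_le:
  assumes "n \<ge> 1"
  shows "avg A (\<lambda>x. f x * g x) ^ (2 ^ n) \<le> avg A (\<lambda>x. f x ^ (2 ^ n)) * avg A (\<lambda>x. g x ^ (2 ^ n))"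
proof -
  obtain m where n: "n = Suc m" using assms by (cases n) auto
  have "avg A (\<lambda>x. f x * g x) ^ (2 ^ n) = ((avg A (\<lambda>x. f x * g x))\<^sup>2) ^ (2 ^ m)"
    by (simp add: n power_mult)
  also have "\<dots> \<le> (avg A (\<lambda>x. (f x)\<^sup>2) * avg A (\<lambda>x. (g x)\<^sup>2)) ^ (2 ^ m)"
    by (intro power_mono avg_mult_square_le) simp
  also have "\<dots> \<le> avg A (\<lambda>x. ((f x)\<^sup>2) ^ (2 ^ m)) * avg A (\<lambda>x. ((g x)\<^sup>2) ^ (2 ^ m))"
    unfolding power_mult_distrib
    by (rule mult_mono[OF avg_power_le avg_power_le avg_nonneg zero_le_power[OF avg_nonneg]]) auto
  finally show ?thesis by (simp add: n power_mult)
qed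

section \<open>Averages over lists with entries from prescribed sets\<close>

lemma set_Cons_image: "set_Cons A X = (\<lambda>(x, xs). x # xs) ` (A \<times> X)"
  by (auto simp: set_Cons_def)

lemma finite_listset: "(\<And>D. D \<in> set Ds \<Longrightarrow> finite D) \<Longrightarrow> finite (listset Ds)"
  by (induction Ds) (auto simp: set_Cons_image)

lemma card_listset: "card (listset Ds) = prod_list (map card Ds)"
proof (induction Ds)
  case (Cons D Ds)
  have "inj_on (\<lambda>(x, xs). x # xs) (D \<times> listset Ds)" by (auto simp: inj_on_def)
  from card_image[OF this] have "card (set_Cons D (listset Ds)) = card D * card (listset Ds)"
    unfolding set_Cons_image card_cartesian_product .
  thus ?case unfolding listset.simps list.map prod_list.Cons Cons.IH .
qed simp

lemma listset_length: "ds \<in> listset Ds \<Longrightarrow> length ds = length Ds"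
  by (induction Ds arbitrary: ds) (auto simp: set_Cons_def)

lemma avg_listset_Nil [simp]: "avg (listset []) f = f []"
  by (simp add: avg_def)

lemma avg_listset_Cons: "avg (listset (D # Ds)) f = avg D (\<lambda>d. avg (listset Ds) (\<lambda>ds. f (d # ds)))"
proof -
  have "(\<Sum>ds\<in>listset (D # Ds). f ds) = (\<Sum>d\<in>D. \<Sum>ds\<in>listset Ds. f (d # ds))"
    by (simp add: set_Cons_image sum.reindex inj_on_def sum.cartesian_product case_prod_beta)
  moreover have "card (listset (D # Ds)) = card D * card (listset Ds)"
    by (simp add: card_listset del: listset.simps)
  ultimately show ?thesis by (simp add: avg_def sum_divide_distrib mult.commute del: listset.simps)
qed

lemma avg_listset_append:
  "avg (listset (Ds @ Es)) f = avg (listset Ds) (\<lambda>ds. avg (listset Es) (\<lambda>es. f (ds @ es)))"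
  by (induction Ds arbitrary: f) (simp_all add: avg_listset_Cons del: listset.simps)

section \<open>Iterated differences and their summation ranges\<close>

fun diffs :: "int list \<Rightarrow> (int \<Rightarrow> real) \<Rightarrow> int \<Rightarrow> real" where
  "diffs [] f = f"
| "diffs (d # ds) f = diffs ds (\<lambda>x. f (x + d) - f x)"

text \<open>The base points for which every point entering the iterated difference lies in
  \<open>A\<close>; this is the range that a differenced sum inherits.\<close>

fun shift_inter :: "int list \<Rightarrow> int set \<Rightarrow> int set" where
  "shift_inter [] A = A"
| "shift_inter (d # ds) A = shift_inter ds {x \<in> A. x + d \<in> A}"

lemma diffs_append: "diffs (ds @ es) f = diffs es (diffs ds f)"
  by (induction ds arbitrary: f) auto

lemma diffs_add: "diffs ds (\<lambda>x. f x + g x) x = diffs ds f x + diffs ds g x"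
proof (induction ds arbitrary: f g)
  case (Cons d ds)
  have "(\<lambda>x. f (x + d) + g (x + d) - (f x + g x)) = (\<lambda>x. (f (x + d) - f x) + (g (x + d) - g x))"
    by (auto simp: fun_eq_iff)
  thus ?case using Cons by simp
qed simp

lemma shift_inter_subset: "shift_inter ds A \<subseteq> A"
proof (induction ds arbitrary: A)
  case (Cons d ds)
  show ?case using Cons[of "{x \<in> A. x + d \<in> A}"] by auto
qed simp

lemma shift_inter_interval: "\<exists>a' b'. shift_inter ds {a..b} = {a'..b'}"
proof (induction ds arbitrary: a b)
  case (Cons d ds)
  have "{x \<in> {a..b}. x + d \<in> {a..b}} = {max a (a - d)..min b (b - d)}" by auto
  thus ?case using Cons by simp
qed auto

lemma sum_pairs_by_difference:
  fixes G :: "int \<Rightarrow> int \<Rightarrow> 'b::comm_monoid_add"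
  assumes "finite A" "finite D" "\<And>x x'. x \<in> A \<Longrightarrow> x' \<in> A \<Longrightarrow> x' - x \<in> D"
  shows "(\<Sum>x\<in>A. \<Sum>x'\<in>A. G x x') = (\<Sum>d\<in>D. \<Sum>x\<in>{x \<in> A. x + d \<in> A}. G x (x + d))"
proof -
  have "(\<Sum>d\<in>D. \<Sum>x\<in>{x \<in> A. x + d \<in> A}. G x (x + d)) = (\<Sum>x\<in>A. \<Sum>d\<in>{d \<in> D. x + d \<in> A}. G x (x + d))"
    by (rule sum.swap_restrict) (use assms in auto)
  also have "\<dots> = (\<Sum>x\<in>A. \<Sum>x'\<in>A. G x x')"
  proof (rule sum.cong[OF refl])
    fix x assume "x \<in> A"
    show "(\<Sum>d\<in>{d \<in> D. x + d \<in> A}. G x (x + d)) = (\<Sum>x'\<in>A. G x x')"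
      by (rule sum.reindex_bij_witness[of _ "\<lambda>x'. x' - x" "\<lambda>d. x + d"]) (use assms(3)[OF \<open>x \<in> A\<close>] in auto)
  qed
  finally show ?thesis ..
qed

text \<open>Cauchy's inequality is applied over \<open>y\<close> and the square is opened in
  \<open>x\<close> alone, so both points of a pair share the same \<open>y\<close>. The sum over
  \<open>B\<close> therefore reappears intact inside the norm and the step can be repeated.\<close>

lemma weyl_step:
  fixes F :: "int \<Rightarrow> 'b \<Rightarrow> real"
  assumes "finite A" "finite D" "\<And>x x'. x \<in> A \<Longrightarrow> x' \<in> A \<Longrightarrow> x' - x \<in> D"
  shows "(norm (\<Sum>x\<in>A. \<Sum>y\<in>B. unit_exp (F x y)))\<^sup>2
    \<le> real (card B) * (\<Sum>d\<in>D. norm (\<Sum>x\<in>{x \<in> A. x + d \<in> A}. \<Sum>y\<in>B. unit_exp (F (x + d) y - F x y)))"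
proof -
  define T where "T y = (\<Sum>x\<in>A. unit_exp (F x y))" for y
  have "(norm (\<Sum>x\<in>A. \<Sum>y\<in>B. unit_exp (F x y)))\<^sup>2 = (norm (\<Sum>y\<in>B. T y))\<^sup>2"
    unfolding T_def by (subst sum.swap) simp
  also have "\<dots> \<le> (\<Sum>y\<in>B. norm (T y) * 1)\<^sup>2"
    by (intro power_mono) (auto intro: norm_sum)
  also have "\<dots> \<le> (\<Sum>y\<in>B. (norm (T y))\<^sup>2) * (\<Sum>y\<in>B. 1\<^sup>2)"
    by (rule Cauchy_Schwarz_ineq_sum)
  also have "\<dots> = real (card B) * (\<Sum>y\<in>B. (norm (T y))\<^sup>2)" by simp
  also have "(\<Sum>y\<in>B. (norm (T y))\<^sup>2) = norm (complex_of_real (\<Sum>y\<in>B. (norm (T y))\<^sup>2))"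
    unfolding norm_of_real by (simp add: sum_nonneg)
  also have "complex_of_real (\<Sum>y\<in>B. (norm (T y))\<^sup>2)
      = (\<Sum>y\<in>B. \<Sum>x\<in>A. \<Sum>x'\<in>A. unit_exp (F x' y - F x y))"
    unfolding of_real_sum complex_norm_square T_def cnj_sum sum_product unit_exp_diff
    by (rule sum.cong[OF refl], rule sum.swap)
  also have "\<dots> = (\<Sum>x\<in>A. \<Sum>x'\<in>A. \<Sum>y\<in>B. unit_exp (F x' y - F x y))"
    by (subst sum.swap, rule sum.cong[OF refl], rule sum.swap)
  also have "\<dots> = (\<Sum>d\<in>D. \<Sum>x\<in>{x \<in> A. x + d \<in> A}. \<Sum>y\<in>B. unit_exp (F (x + d) y - F x y))"
    by (rule sum_pairs_by_difference) (use assms in auto)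
  finally show ?thesis
    by (rule order_trans) (intro mult_left_mono norm_sum, simp)
qed

text \<open>With the normalisation \<open>card B * card D\<close> the one-step bound is an average
  over \<open>D\<close> of quotients of the same shape. The induction thus reproduces the statement,
  with \<open>D\<close> fixed while \<open>A\<close> shrinks.\<close>

lemma weyl_differencing:
  fixes F :: "int \<Rightarrow> 'b \<Rightarrow> real"
  assumes "finite A" "finite D" "\<And>x x'. x \<in> A \<Longrightarrow> x' \<in> A \<Longrightarrow> x' - x \<in> D"
  shows "(norm (\<Sum>x\<in>A. \<Sum>y\<in>B. unit_exp (F x y)) / (real (card B) * real (card D))) ^ (2 ^ j)
    \<le> avg (listset (replicate j D)) (\<lambda>ds. norm (\<Sum>x\<in>shift_inter ds A. \<Sum>y\<in>B.
          unit_exp (diffs ds (\<lambda>x. F x y) x)) / (real (card B) * real (card D)))"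
  using assms
proof (induction j arbitrary: A F)
  case (Suc j)
  let ?N = "real (card B) * real (card D)"
  let ?A = "\<lambda>d. {x \<in> A. x + d \<in> A}"
  let ?T = "\<lambda>d. norm (\<Sum>x\<in>?A d. \<Sum>y\<in>B. unit_exp (F (x + d) y - F x y)) / ?N"
  have "(norm (\<Sum>x\<in>A. \<Sum>y\<in>B. unit_exp (F x y)) / ?N)\<^sup>2 \<le>
      (real (card B) * (\<Sum>d\<in>D. norm (\<Sum>x\<in>?A d. \<Sum>y\<in>B. unit_exp (F (x + d) y - F x y)))) / ?N\<^sup>2"
    unfolding power_divide by (intro divide_right_mono weyl_step) (use Suc.prems in auto)
  also have "\<dots> = avg D ?T"
    by (simp add: avg_def power2_eq_square sum_divide_distrib[symmetric])
  finally have step: "(norm (\<Sum>x\<in>A. \<Sum>y\<in>B. unit_exp (F x y)) / ?N)\<^sup>2 \<le> avg D ?T" .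
  have "(norm (\<Sum>x\<in>A. \<Sum>y\<in>B. unit_exp (F x y)) / ?N) ^ (2 ^ Suc j)
      = ((norm (\<Sum>x\<in>A. \<Sum>y\<in>B. unit_exp (F x y)) / ?N)\<^sup>2) ^ (2 ^ j)"
    by (simp only: power_mult power_Suc)
  also have "\<dots> \<le> avg D ?T ^ (2 ^ j)"
    by (intro power_mono step) simp
  also have "\<dots> \<le> avg D (\<lambda>d. ?T d ^ (2 ^ j))"
    by (rule avg_power_le) simp
  also have "\<dots> \<le> avg D (\<lambda>d. avg (listset (replicate j D)) (\<lambda>ds. norm (\<Sum>x\<in>shift_inter ds (?A d). \<Sum>y\<in>B.
          unit_exp (diffs ds (\<lambda>x. F (x + d) y - F x y) x)) / ?N))"
    by (intro avg_mono Suc.IH) (use Suc.prems in auto)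
  finally show ?case by (simp add: avg_listset_Cons del: listset.simps)
qed (simp add: avg_def)

section \<open>Differences of polynomials\<close>

lemma degree_le_1E:
  assumes "degree p \<le> 1"
  obtains a b where "p = [:a, b:]"
proof -
  obtain a q where "p = pCons a q" by (cases p)
  moreover have "degree q = 0" using assms \<open>p = pCons a q\<close> by (auto split: if_splits)
  ultimately show ?thesis using that by (metis degree_eq_zeroE)
qed

lemma poly_difference:
  fixes p :: "real poly"
  assumes "degree p \<le> Suc n"
  shows "\<exists>q. degree q \<le> n \<and> coeff q n = real (Suc n) * d * coeff p (Suc n)
    \<and> (\<forall>x. poly q x = poly p (x + d) - poly p x)"
  using assms
proof (induction n arbitrary: p)
  case 0
  then obtain a b where p: "p = [:a, b:]"
    using degree_le_1E by auto
  show ?case by (rule exI[of _ "[:d * b:]"]) (simp add: p algebra_simps)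
next
  case (Suc n)
  obtain a r where p: "p = pCons a r" by (cases p)
  have r: "degree r \<le> Suc n" using Suc.prems by (auto simp: p split: if_splits)
  from Suc.IH[OF this] obtain q where q: "degree q \<le> n" "coeff q n = real (Suc n) * d * coeff r (Suc n)"
    "\<And>x. poly q x = poly r (x + d) - poly r x" by blast
  have "coeff q (Suc n) = 0" using q(1) by (simp add: coeff_eq_0)
  \<comment> \<open>For p = a + x r(x) and q the difference of r, the difference of p is x q + d q +
    d r.\<close>
  show ?case
  proof (intro exI conjI allI)
    have "degree (pCons 0 q + smult d q) \<le> Suc n"
      using q(1) by (intro degree_add_le order_trans[OF degree_pCons_le] order_trans[OF degree_smult_le]) auto
    thus "degree (pCons 0 q + smult d q + smult d r) \<le> Suc n"
      using order_trans[OF degree_smult_le r] by (rule degree_add_le)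
    show "coeff (pCons 0 q + smult d q + smult d r) (Suc n) = real (Suc (Suc n)) * d * coeff p (Suc (Suc n))"
      using q(2) \<open>coeff q (Suc n) = 0\<close> by (simp add: p algebra_simps)
    show "poly (pCons 0 q + smult d q + smult d r) x = poly p (x + d) - poly p x" for x
      by (simp add: p q(3) algebra_simps)
  qed
qed

text \<open>Each difference lowers the degree bound by one and multiplies the top coefficient by the
  degree and the step. Keeping \<open>fact n\<close> on the left expresses the resulting falling
  factorial without division. The cases \<open>n = 0\<close> and \<open>n = 1\<close> give the two
  lemmas that follow.\<close>

lemma diffs_poly:
  fixes p :: "real poly"
  assumes "degree p \<le> length ds + n"
  shows "\<exists>q. degree q \<le> n \<and> coeff q n * fact n = fact (length ds + n) * real_of_int (prod_list ds) * coeff p (length ds + n)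
    \<and> (\<forall>x. diffs ds (\<lambda>x. poly p (of_int x)) x = poly q (of_int x))"
  using assms
proof (induction ds arbitrary: p)
  case Nil
  show ?case by (rule exI[of _ p]) (use Nil in auto)
next
  case (Cons d ds)
  have "degree p \<le> Suc (length ds + n)" using Cons.prems by simp
  from poly_difference[OF this, of "of_int d"] obtain q where q: "degree q \<le> length ds + n"
    "coeff q (length ds + n) = real (Suc (length ds + n)) * of_int d * coeff p (Suc (length ds + n))"
    "\<And>x. poly q x = poly p (x + of_int d) - poly p x" by blast
  from Cons.IH[OF q(1)] obtain r where r: "degree r \<le> n"
    "coeff r n * fact n = fact (length ds + n) * real_of_int (prod_list ds) * coeff q (length ds + n)"
    "\<And>x. diffs ds (\<lambda>x. poly q (of_int x)) x = poly r (of_int x)" by blast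
  show ?case
    by (rule exI[of _ r]) (use r in \<open>simp add: q(2) flip: q(3)\<close>)
qed

lemma diffs_power_const:
  fixes c :: "nat \<Rightarrow> real"
  shows "diffs ds (\<lambda>x. \<Sum>i\<le>length ds. c i * of_int x ^ i) x = fact (length ds) * real_of_int (prod_list ds) * c (length ds)"
proof -
  let ?n = "length ds"
  define p where "p = (\<Sum>i\<le>?n. monom (c i) i)"
  have "degree p \<le> ?n + 0"
    unfolding p_def by (intro degree_sum_le) (auto intro: order_trans[OF degree_monom_le])
  from diffs_poly[OF this] obtain q where "degree q \<le> 0"
      and q: "coeff q 0 * fact 0 = fact (?n + 0) * real_of_int (prod_list ds) * coeff p (?n + 0)"
      "\<And>x. diffs ds (\<lambda>x. poly p (of_int x)) x = poly q (of_int x)" by blast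
  moreover obtain a where "q = [:a:]" using \<open>degree q \<le> 0\<close> by (metis degree_eq_zeroE le_zero_eq)
  moreover have "coeff p ?n = c ?n" by (simp add: p_def coeff_sum)
  moreover have "(\<lambda>x. poly p (of_int x)) = (\<lambda>x::int. \<Sum>i\<le>?n. c i * of_int x ^ i)"
    by (simp add: p_def poly_sum poly_monom fun_eq_iff)
  ultimately show ?thesis by simp
qed

lemma diffs_power_linear:
  "\<exists>b. \<forall>x. diffs ds (\<lambda>x. c * of_int x ^ (length ds + 1)) x = c * fact (length ds + 1) * real_of_int (prod_list ds) * of_int x + b"
proof -
  let ?n = "length ds"
  have "degree (monom c (?n + 1)) \<le> ?n + 1" by (rule degree_monom_le)
  from diffs_poly[OF this] obtain q where "degree q \<le> 1"
      and q: "coeff q 1 * fact 1 = fact (?n + 1) * real_of_int (prod_list ds) * coeff (monom c (?n + 1)) (?n + 1)"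
      "\<And>x. diffs ds (\<lambda>x. poly (monom c (?n + 1)) (of_int x)) x = poly q (of_int x)" by blast
  moreover obtain a b where "q = [:a, b:]"
    using \<open>degree q \<le> 1\<close> by (rule degree_le_1E)
  ultimately show ?thesis
    by (intro exI[of _ a]) (auto simp: poly_monom mult_ac)
qed

section \<open>Divisors and sums of reciprocals\<close>

definition num_divisors :: "nat \<Rightarrow> nat" where "num_divisors n = card {d. d dvd n}"

lemma num_divisors_mult_le:
  assumes "m > 0" "n > 0"
  shows "num_divisors (m * n) \<le> num_divisors m * num_divisors n"
proof -
  have "{d. d dvd m * n} \<subseteq> (\<lambda>(a, b). a * b) ` ({d. d dvd m} \<times> {d. d dvd n})"
  proof
    fix d assume "d \<in> {d. d dvd m * n}"
    then obtain a b where "d = a * b" "a dvd m" "b dvd n" using division_decomp by blast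
    thus "d \<in> (\<lambda>(a, b). a * b) ` ({d. d dvd m} \<times> {d. d dvd n})" by force
  qed
  hence "card {d. d dvd m * n} \<le> card ({d. d dvd m} \<times> {d. d dvd n})"
    by (rule surj_card_le[rotated]) (use assms in auto)
  thus ?thesis by (simp add: num_divisors_def card_cartesian_product)
qed

lemma num_divisors_prime_power:
  assumes "prime p" shows "num_divisors (p ^ a) \<le> a + 1"
proof -
  have "{d. d dvd p ^ a} = (\<lambda>i. p ^ i) ` {..a}"
    using divides_primepow_nat[OF assms] by auto
  thus ?thesis using card_image_le[of "{..a}" "\<lambda>i. p ^ i"] by (simp add: num_divisors_def)
qed

lemma num_divisors_prod_prime_powers:
  assumes "finite S" "\<And>p. p \<in> S \<Longrightarrow> prime p"
  shows "num_divisors (\<Prod>p\<in>S. p ^ a p) \<le> (\<Prod>p\<in>S. a p + 1)"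
  using assms
proof (induction S)
  case (insert p S)
  have "num_divisors (\<Prod>p\<in>insert p S. p ^ a p) \<le> num_divisors (p ^ a p) * num_divisors (\<Prod>p\<in>S. p ^ a p)"
    using insert by (simp add: num_divisors_mult_le prod_pos prime_gt_0_nat)
  also have "\<dots> \<le> (a p + 1) * (\<Prod>p\<in>S. a p + 1)"
    using insert num_divisors_prime_power[of p] by (intro mult_mono) auto
  finally show ?case using insert by simp
qed (simp add: num_divisors_def)

text \<open>Compare \<open>a + 1\<close> with p^(a \<epsilon>) prime by prime. Primes above
  2^(1/\<epsilon>) lose nothing because \<open>a + 1 <= 2^a\<close>; each of the finitely many
  others costs at most a constant factor \<open>B\<close>.\<close>

lemma divisor_bound:
  assumes "\<epsilon> > 0"
  obtains C :: real where "C \<ge> 1" "\<And>n. n > 0 \<Longrightarrow> real (num_divisors n) \<le> C * real n powr \<epsilon>"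
proof -
  define P where "P = nat \<lceil>2 powr (1 / \<epsilon>)\<rceil>"
  \<comment> \<open>Chosen so that \<open>B\<close> times \<open>1 + a * \<epsilon> * ln 2\<close>,
    a lower bound for 2^(a \<epsilon>) without the \<open>B\<close>, is at least
    \<open>1 + a\<close>.\<close>
  define B where "B = max 1 (1 / (\<epsilon> * ln 2))"
  have B: "B \<ge> 1" "1 \<le> B * (\<epsilon> * ln 2)" using assms by (auto simp: B_def max_def field_simps)
  define c where "c p = (if p \<in> {..P} then B else 1)" for p :: nat
  have local: "real (a + 1) \<le> c p * (real p ^ a) powr \<epsilon>" if "prime p" for p a
  proof -
    have p: "real p \<ge> 2" using prime_ge_2_nat[OF that] by simp
    have pa: "(real p ^ a) powr \<epsilon> = (real p powr \<epsilon>) ^ a"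
      using p by (simp add: powr_realpow[symmetric] powr_powr mult.commute powr_gt_zero)
    show ?thesis
    proof (cases "p \<le> P")
      case True
      have "1 + real a * (\<epsilon> * ln 2) \<le> exp (real a * (\<epsilon> * ln 2))" by (rule exp_ge_add_one_self)
      also have "\<dots> = (2 powr \<epsilon>) ^ a" by (simp add: powr_def exp_of_nat_mult)
      also have "\<dots> \<le> (real p powr \<epsilon>) ^ a" using p assms by (intro power_mono powr_mono2) auto
      finally have "B * (1 + real a * (\<epsilon> * ln 2)) \<le> B * (real p powr \<epsilon>) ^ a" using B by (intro mult_left_mono) auto
      moreover have "real a * 1 \<le> real a * (B * (\<epsilon> * ln 2))" using B by (intro mult_left_mono) auto
      ultimately show ?thesis using True B by (simp add: c_def pa algebra_simps)
    next
      case False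
      have "2 = (2 powr (1 / \<epsilon>)) powr \<epsilon>" using assms by (simp add: powr_powr)
      also have "\<dots> \<le> real p powr \<epsilon>"
      proof (rule powr_mono2)
        show "2 powr (1 / \<epsilon>) \<le> real p" using False real_nat_ceiling_ge[of "2 powr (1 / \<epsilon>)"] unfolding P_def by linarith
      qed (use assms in auto)
      finally have "(2::real) ^ a \<le> (real p powr \<epsilon>) ^ a" by (intro power_mono) auto
      moreover have "real (a + 1) \<le> 2 ^ a" by (induction a) auto
      ultimately show ?thesis using False by (simp add: c_def pa)
    qed
  qed
  have "real (num_divisors n) \<le> B ^ Suc P * real n powr \<epsilon>" if "n > 0" for n
  proof -
    let ?S = "prime_factors n" and ?a = "\<lambda>p. multiplicity p n"
    have n: "n = (\<Prod>p\<in>?S. p ^ ?a p)" by (rule prime_factorization_nat[OF that])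
    have "num_divisors n \<le> (\<Prod>p\<in>?S. ?a p + 1)"
      by (subst n, rule num_divisors_prod_prime_powers) auto
    hence "real (num_divisors n) \<le> (\<Prod>p\<in>?S. real (?a p + 1))"
      by (metis of_nat_le_iff of_nat_prod)
    also have "\<dots> \<le> (\<Prod>p\<in>?S. c p * (real p ^ ?a p) powr \<epsilon>)"
      by (intro prod_mono conjI local) auto
    also have "\<dots> = (\<Prod>p\<in>?S. c p) * real n powr \<epsilon>"
    proof -
      have "real n = (\<Prod>p\<in>?S. real p ^ ?a p)" by (subst n) simp
      thus ?thesis by (simp add: prod.distrib prod_powr_distrib)
    qed
    also have "(\<Prod>p\<in>?S. c p) \<le> B ^ Suc P"
    proof -
      have "(\<Prod>p\<in>?S. c p) = B ^ card (?S \<inter> {..P})"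
        by (simp add: c_def prod.If_cases atMost_def)
      also have "\<dots> \<le> B ^ card {..P}" using B by (intro power_increasing card_mono) auto
      finally show ?thesis by simp
    qed
    finally show ?thesis by (simp add: mult_right_mono)
  qed
  moreover have "B ^ Suc P \<ge> 1" using B by (intro one_le_power)
  ultimately show ?thesis using that by blast
qed

lemma harm_powr_bound:
  assumes "0 < \<epsilon>" "\<epsilon> \<le> 1" "n > 0"
  shows "harm n \<le> 2 / \<epsilon> * real n powr \<epsilon>"
proof -
  have "harm n \<le> 1 + ln (real n)"
    using euler_mascheroni_sequence_decreasing[of 1 n] assms by (simp add: harm_def)
  also have "\<dots> \<le> real n powr \<epsilon> / \<epsilon> + real n powr \<epsilon> / \<epsilon>"
  proof (intro add_mono ln_powr_bound)
    have "1 \<le> real n powr \<epsilon>" using assms by (intro ge_one_powr_ge_zero) auto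
    also have "\<dots> \<le> real n powr \<epsilon> / \<epsilon>" using assms by (simp add: le_divide_eq mult_left_le)
    finally show "1 \<le> real n powr \<epsilon> / \<epsilon>" .
  qed (use assms in auto)
  finally show ?thesis by simp
qed

section \<open>Reciprocals of distances along multiples of a real number\<close>

lemma residue_reciprocal_sum:
  "(\<Sum>r\<in>{1..<q}. 1 / real r + 1 / real (q - r)) = 2 * harm (q - 1)"
proof -
  have "{1..<q} = {1..q-1}" by (cases q) auto
  moreover have "(\<Sum>r\<in>{1..<q}. 1 / real (q - r)) = (\<Sum>r\<in>{1..<q}. 1 / real r)"
    by (rule sum.reindex_bij_witness[of _ "\<lambda>r. q - r" "\<lambda>r. q - r"]) auto
  ultimately show ?thesis by (simp add: sum.distrib harm_def inverse_eq_divide)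
qed

lemma nearest_int_dist_rational:
  assumes "0 < r" "r < (q::int)" and k: "m = r + q * k"
  shows "min (real_of_int r) (real_of_int (q - r)) / real_of_int q \<le> nearest_int_dist (real_of_int m / real_of_int q)"
proof -
  have "nearest_int_dist (real_of_int m / real_of_int q) = nearest_int_dist (real_of_int r / real_of_int q)"
    using nearest_int_dist_add_int[of "real_of_int r / real_of_int q" k] assms by (simp add: k field_simps)
  also have "\<dots> = \<bar>real_of_int r / real_of_int q - real_of_int (round (real_of_int r / real_of_int q))\<bar>"
    by (rule nearest_int_dist_round)
  also have "\<dots> \<ge> min (real_of_int r) (real_of_int (q - r)) / real_of_int q"
  proof -
    define u where "u = round (real_of_int r / real_of_int q)"
    have q: "real_of_int q > 0" using assms by simp
    have "min (real_of_int r) (real_of_int (q - r)) \<le> \<bar>real_of_int (r - q * u)\<bar>"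
    proof (cases "u \<le> 0")
      case True
      hence "q * u \<le> 0" using assms by (simp add: mult_nonneg_nonpos)
      thus ?thesis using assms by linarith
    next
      case False
      hence "q * 1 \<le> q * u" using assms by (intro mult_left_mono) auto
      hence "real_of_int q \<le> real_of_int (q * u)" by linarith
      thus ?thesis by (simp del: of_int_mult)
    qed
    also have "\<bar>real_of_int (r - q * u)\<bar> = \<bar>real_of_int r / real_of_int q - real_of_int u\<bar> * real_of_int q"
    proof -
      have "real_of_int (r - q * u) = (real_of_int r / real_of_int q - real_of_int u) * real_of_int q"
        using q by (simp add: field_simps)
      thus ?thesis using q by (simp only: abs_mult abs_of_pos)
    qed
    finally show ?thesis using q by (simp add: u_def divide_le_eq)
  qed
  finally show ?thesis .
qed

text \<open>Let \<open>q\<close> be the denominator of a Dirichlet approximation to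
  \<open>\<beta>\<close>. The dangerous terms are the multiples of \<open>q\<close>: they are rare
  if \<open>q > Z\<close>, and if \<open>q <= Z\<close> then \<open>far\<close> forbids too good an
  approximation. The other \<open>m\<close> stay away from the integers as a fraction with
  denominator \<open>q\<close> does, and each block of length \<open>q\<close> contributes a
  harmonic sum.\<close>

lemma recip_weight_sum_le:
  fixes M :: nat
  assumes M: "M \<ge> 1" and Y: "Y > 0" and Z: "Z > 0"
    and far: "\<And>q::int. 1 \<le> q \<Longrightarrow> of_int q \<le> Z \<Longrightarrow> Z / (real M * Y) < nearest_int_dist (of_int q * \<beta>)"
  shows "(\<Sum>m\<in>{1..M}. recip_weight Y (\<beta> * real m)) \<le> (real M * Y / Z + 12 * real M) * harm (2 * M)"
proof -
  \<comment> \<open>Allowing denominators up to \<open>2 M\<close> keeps the drift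
    \<open>m \<delta>\<close> within 1/2 for \<open>m <= M\<close>: multiples of
    \<open>\<delta>\<close> do not wrap around modulo 1, and a nonzero residue is displaced by at
    most half of \<open>1 / q\<close>.\<close>
  obtain a q' where cop: "coprime a q'" and q'0: "0 < q'" and q'M: "q' \<le> int (2 * M)"
    and approx: "\<bar>of_int q' * \<beta> - of_int a\<bar> < 1 / real (2 * M)"
    using Dirichlet_approx_coprime[of "2 * M" \<beta>] M by auto
  define q where "q = nat q'"
  have q: "q > 0" "q \<le> 2 * M" "q' = int q" using q'0 q'M by (auto simp: q_def)
  define \<delta> where "\<delta> = real q * \<beta> - of_int a"
  have \<delta>: "\<bar>\<delta>\<bar> < 1 / (2 * real M)" using approx q(3) by (simp add: \<delta>_def)
  let ?W = "\<lambda>m. recip_weight Y (\<beta> * real m)"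
  have harm1: "1 \<le> (harm n :: real)" if "n \<ge> 1" for n :: nat
    using harm_mono[OF that, where 'a=real] by (simp add: harm_def)
  define D0 where "D0 = {m \<in> {1..M}. q dvd m}"
  define D1 where "D1 = {m \<in> {1..M}. \<not> q dvd m}"
  have "(\<Sum>m\<in>D0. ?W m) \<le> (\<Sum>t\<in>{1..M div q}. ?W (q * t))"
  proof -
    have "D0 \<subseteq> (\<lambda>t. q * t) ` {1..M div q}"
    proof
      fix m assume "m \<in> D0"
      then obtain t where t: "m = q * t" "1 \<le> m" "m \<le> M" by (auto simp: D0_def)
      hence "t \<le> M div q" using q(1) by (metis div_le_mono nonzero_mult_div_cancel_left less_not_refl)
      moreover have "1 \<le> t" using t by (cases t) auto
      ultimately show "m \<in> (\<lambda>t. q * t) ` {1..M div q}" using t by auto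
    qed
    hence "(\<Sum>m\<in>D0. ?W m) \<le> (\<Sum>m\<in>(\<lambda>t. q * t) ` {1..M div q}. ?W m)"
      by (intro sum_mono2) (auto simp: recip_weight_nonneg[OF Y])
    also have "\<dots> = (\<Sum>t\<in>{1..M div q}. ?W (q * t))"
      using q(1) by (subst sum.reindex) (auto simp: inj_on_def)
    finally show ?thesis .
  qed
  also have "\<dots> \<le> real M * Y / Z * harm (2 * M)"
  proof (cases "real q \<le> Z")
    case False
    have "(\<Sum>t\<in>{1..M div q}. ?W (q * t)) \<le> (\<Sum>t\<in>{1..M div q}. Y)"
      by (intro sum_mono recip_weight_le[OF Y])
    also have "\<dots> = real (M div q) * Y" by simp
    also have "\<dots> \<le> (real M / real q) * Y"
      using Y of_nat_div_le_of_nat[of M q, where 'a=real] by (intro mult_right_mono) auto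
    also have "\<dots> \<le> (real M / Z) * Y"
      using False Y Z by (intro mult_right_mono divide_left_mono) auto
    also have "\<dots> \<le> real M * Y / Z * harm (2 * M)"
      using mult_left_mono[OF harm1[of "2 * M"], of "real M * Y / Z"] M Y Z by simp
    finally show ?thesis .
  next
    case True
    have "\<bar>\<delta>\<bar> \<le> 1 / 2" using \<delta> M by (smt (verit) frac_le of_nat_1 of_nat_mono)
    hence "nearest_int_dist \<delta> = \<bar>\<delta>\<bar>" by (rule nearest_int_dist_small)
    moreover have "nearest_int_dist (of_int (int q) * \<beta>) = nearest_int_dist \<delta>"
      using nearest_int_dist_add_int[of \<delta> a] by (simp add: \<delta>_def)
    ultimately have big: "Z / (real M * Y) < \<bar>\<delta>\<bar>" using far[of "int q"] True q(1) by simp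
    have "?W (q * t) \<le> (real M * Y / Z) * (1 / real t)" if t: "t \<in> {1..M div q}" for t
    proof -
      have tM: "real t \<le> real M"
        using t q(1) by (metis atLeastAtMost_iff div_le_dividend le_trans of_nat_le_iff)
      have "\<bar>real t * \<delta>\<bar> \<le> real M * (1 / (2 * real M))"
        unfolding abs_mult using \<delta> tM by (intro mult_mono) auto
      hence "\<bar>real t * \<delta>\<bar> \<le> 1 / 2" using M by simp
      hence "nearest_int_dist (real t * \<delta>) = real t * \<bar>\<delta>\<bar>"
        by (simp add: nearest_int_dist_small abs_mult)
      moreover have "\<beta> * real (q * t) = real t * \<delta> + of_int (int t * a)"
        by (simp add: \<delta>_def algebra_simps)
      ultimately have "nearest_int_dist (\<beta> * real (q * t)) = real t * \<bar>\<delta>\<bar>"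
        by (simp only: nearest_int_dist_add_int)
      moreover have "real t * (Z / (real M * Y)) \<le> real t * \<bar>\<delta>\<bar>" using big by (intro mult_left_mono) auto
      ultimately have "?W (q * t) \<le> 1 / (real t * (Z / (real M * Y)))"
        using t M Y Z by (intro recip_weight_le_inverse) auto
      thus ?thesis by (simp add: mult.commute)
    qed
    hence "(\<Sum>t\<in>{1..M div q}. ?W (q * t)) \<le> (\<Sum>t\<in>{1..M div q}. (real M * Y / Z) * (1 / real t))"
      by (intro sum_mono)
    also have "\<dots> = (real M * Y / Z) * harm (M div q)"
      by (simp add: harm_def inverse_eq_divide sum_distrib_left)
    also have "\<dots> \<le> (real M * Y / Z) * harm (2 * M)"
      using M Y Z by (intro mult_left_mono harm_mono) (auto intro: order_trans[OF div_le_dividend])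
    finally show ?thesis .
  qed
  finally have S0: "(\<Sum>m\<in>D0. ?W m) \<le> real M * Y / Z * harm (2 * M)" .

  define r where "r m = nat ((a * int m) mod int q)" for m
  define V where "V s = 2 * real q * (1 / real s + 1 / real (q - s))" for s
  have r_bounds: "r m \<in> {1..<q}" if "m \<in> D1" for m
  proof -
    have "\<not> int q dvd a * int m"
      using that cop q by (simp add: D1_def coprime_dvd_mult_right_iff coprime_commute)
    hence "(a * int m) mod int q \<noteq> 0" by (simp add: dvd_eq_mod_eq_0)
    moreover have "0 \<le> (a * int m) mod int q" "(a * int m) mod int q < int q" using q(1) by auto
    ultimately show ?thesis unfolding r_def by auto
  qed
  have W_le: "?W m \<le> V (r m)" if "m \<in> D1" for m
  proof -
    note rb = r_bounds[OF that]
    define s where "s = min (real (r m)) (real (q - r m))"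
    have s1: "s \<ge> 1" using rb by (auto simp: s_def)
    have eq: "a * int m = int (r m) + int q * (a * int m div int q)"
      using q(1) by (simp add: r_def)
    have "s / real q \<le> nearest_int_dist (of_int (a * int m) / real q)"
      using nearest_int_dist_rational[of "int (r m)" "int q", OF _ _ eq] rb by (simp add: s_def of_nat_diff)
    also have "of_int (a * int m) / real q = \<beta> * real m + (- (real m * \<delta> / real q))"
      using q(1) by (simp add: \<delta>_def field_simps)
    also have "nearest_int_dist \<dots> \<le> nearest_int_dist (\<beta> * real m) + nearest_int_dist (- (real m * \<delta> / real q))"
      by (rule nearest_int_dist_triangle)
    also have "nearest_int_dist (- (real m * \<delta> / real q)) \<le> real m * \<bar>\<delta>\<bar> / real q"
      using nearest_int_dist_le[of "real m * \<delta> / real q" 0] by (simp add: abs_mult)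
    also have "real m * \<bar>\<delta>\<bar> \<le> real M * (1 / (2 * real M))"
      using \<delta> that by (intro mult_mono) (auto simp: D1_def)
    also have "\<dots> = 1 / 2" using M by simp
    finally have "s / real q \<le> nearest_int_dist (\<beta> * real m) + 1 / 2 / real q"
      using q(1) by (simp add: divide_right_mono)
    moreover have "s / (2 * real q) \<le> s / real q - 1 / 2 / real q"
      using s1 q(1) by (simp add: field_simps)
    ultimately have "?W m \<le> 1 / (s / (2 * real q))"
      using s1 q(1) by (intro recip_weight_le_inverse[OF Y]) auto
    also have "\<dots> = 2 * real q * (1 / s)" by simp
    also have "\<dots> \<le> V (r m)" unfolding V_def
      by (intro mult_left_mono) (auto simp: s_def min_def)
    finally show ?thesis .
  qed
  have "(\<Sum>m\<in>D1. ?W m) \<le> (\<Sum>m\<in>D1. V (r m))" by (intro sum_mono W_le)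
  also have "\<dots> = (\<Sum>(t, s)\<in>(\<lambda>m. (m div q, r m)) ` D1. V s)"
  proof (subst sum.reindex)
    show "inj_on (\<lambda>m. (m div q, r m)) D1"
    proof (rule inj_onI)
      fix m m' assume "m \<in> D1" "m' \<in> D1" and eq: "(m div q, r m) = (m' div q, r m')"
      hence "(a * int m) mod int q = (a * int m') mod int q"
        using q(1) by (simp add: r_def eq_nat_nat_iff)
      hence "int q dvd a * (int m - int m')" by (simp add: mod_eq_dvd_iff right_diff_distrib)
      hence "int q dvd int m - int m'" using cop q by (simp add: coprime_dvd_mult_right_iff coprime_commute)
      hence "int m mod int q = int m' mod int q" by (simp add: mod_eq_dvd_iff)
      hence "m mod q = m' mod q" by (metis of_nat_eq_iff of_nat_mod)
      with eq show "m = m'" by (metis Pair_inject div_mult_mod_eq)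
    qed
  qed simp
  also have "\<dots> \<le> (\<Sum>(t, s)\<in>{0..M div q} \<times> {1..<q}. V s)"
  proof (rule sum_mono2)
    show "(\<lambda>m. (m div q, r m)) ` D1 \<subseteq> {0..M div q} \<times> {1..<q}"
      using r_bounds by (auto simp: D1_def div_le_mono)
  qed (auto simp: V_def)
  also have "\<dots> = real (M div q + 1) * (\<Sum>s\<in>{1..<q}. V s)"
    by (simp flip: sum.cartesian_product)
  also have "(\<Sum>s\<in>{1..<q}. V s) = 2 * real q * (2 * harm (q - 1))"
    unfolding V_def sum_distrib_left[symmetric] residue_reciprocal_sum ..
  also have "\<dots> = real q * (4 * harm (q - 1))" by simp
  also have "real (M div q + 1) * (real q * (4 * harm (q - 1))) = real ((M div q + 1) * q) * (4 * harm (q - 1))"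
    by (simp only: of_nat_mult mult.assoc)
  \<comment> \<open>The \<open>+ 1\<close> counts the incomplete block, and
    \<open>(M div q + 1) * q <= M + q <= 3 * M\<close> because \<open>q <= 2 * M\<close>.\<close>
  also have "\<dots> \<le> real (3 * M) * (4 * harm (2 * M))"
  proof (intro mult_mono)
    show "real ((M div q + 1) * q) \<le> real (3 * M)"
    proof -
      have "(M div q + 1) * q \<le> 3 * M" using q(2) div_times_less_eq_dividend[of M q] by (simp only: distrib_right)
      thus ?thesis by (rule of_nat_mono)
    qed
  qed (use q in \<open>auto intro!: harm_mono harm_nonneg\<close>)
  finally have S1: "(\<Sum>m\<in>D1. ?W m) \<le> 12 * real M * harm (2 * M)" by simp
  have "(\<Sum>m\<in>{1..M}. ?W m) = (\<Sum>m\<in>D0. ?W m) + (\<Sum>m\<in>D1. ?W m)"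
  proof -
    have "{1..M} = D0 \<union> D1" "D0 \<inter> D1 = {}" by (auto simp: D0_def D1_def)
    thus ?thesis by (metis (no_types, lifting) finite_Un finite_atLeastAtMost sum.union_disjoint)
  qed
  with S0 S1 show ?thesis by (simp add: distrib_right)
qed

section \<open>Lists of integers with a given product\<close>

lemma card_listset_prod_zero:
  assumes "\<And>D. D \<in> set Ds \<Longrightarrow> finite D" "\<And>D. D \<in> set Ds \<Longrightarrow> 0 \<in> D \<Longrightarrow> L \<le> real (card D)" "L > 0"
  shows "real (card {ds \<in> listset Ds. prod_list ds = (0::int)}) * L \<le> real (length Ds) * real (card (listset Ds))"
  using assms(1,2)
proof (induction Ds)
  case (Cons D Ds)
  let ?Z = "\<lambda>Ds. {ds \<in> listset Ds. prod_list ds = (0::int)}"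
  have fin: "finite (listset Ds)" "finite D" using Cons.prems finite_listset[of Ds] by auto
  \<comment> \<open>Either the head is 0 or the tail has product 0. A set \<open>D\<close> without 0
    contributes nothing of the first kind, so no lower bound for its size enters.\<close>
  have "?Z (D # Ds) \<subseteq> (\<lambda>ds. 0 # ds) ` (if 0 \<in> D then listset Ds else {}) \<union> (\<lambda>(d, ds). d # ds) ` (D \<times> ?Z Ds)"
    by (auto simp: set_Cons_def)
  hence "card (?Z (D # Ds)) \<le> card ((\<lambda>ds. 0 # ds) ` (if 0 \<in> D then listset Ds else {}) \<union> (\<lambda>(d, ds). d # ds) ` (D \<times> ?Z Ds))"
    using fin by (intro card_mono) auto
  also have "\<dots> \<le> card ((\<lambda>ds. 0 # ds) ` (if 0 \<in> D then listset Ds else {})) + card ((\<lambda>(d, ds). d # ds) ` (D \<times> ?Z Ds))"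
    by (rule card_Un_le)
  also have "\<dots> \<le> card (if 0 \<in> D then listset Ds else {}) + card (D \<times> ?Z Ds)"
    using fin by (intro add_mono card_image_le) auto
  also have "\<dots> = (if 0 \<in> D then card (listset Ds) else 0) + card D * card (?Z Ds)"
    by (simp add: card_cartesian_product)
  finally have le: "card (?Z (D # Ds)) \<le> (if 0 \<in> D then card (listset Ds) else 0) + card D * card (?Z Ds)" .
  have "real (card (?Z (D # Ds))) * L \<le> real ((if 0 \<in> D then card (listset Ds) else 0) + card D * card (?Z Ds)) * L"
    by (rule mult_right_mono[OF of_nat_mono[OF le] less_imp_le[OF assms(3)]])
  also have "\<dots> = real (if 0 \<in> D then card (listset Ds) else 0) * L + real (card D) * (real (card (?Z Ds)) * L)"
    by (simp add: algebra_simps)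
  also have "\<dots> \<le> real (card (listset Ds)) * real (card D) + real (card D) * (real (length Ds) * real (card (listset Ds)))"
  proof (rule add_mono)
    show "real (if 0 \<in> D then card (listset Ds) else 0) * L \<le> real (card (listset Ds)) * real (card D)"
      using Cons.prems(2)[of D] by (cases "0 \<in> D") (simp_all add: mult_left_mono)
    have "real (card (?Z Ds)) * L \<le> real (length Ds) * real (card (listset Ds))"
      by (rule Cons.IH) (use Cons.prems in auto)
    thus "real (card D) * (real (card (?Z Ds)) * L) \<le> real (card D) * (real (length Ds) * real (card (listset Ds)))"
      by (rule mult_left_mono) simp
  qed
  also have "\<dots> = real (length (D # Ds)) * real (card (listset (D # Ds)))"
    by (simp add: card_listset algebra_simps del: listset.simps)
  finally show ?case .
next
  case Nil
  have "{ds \<in> listset []. prod_list ds = (0::int)} = {}" by auto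
  thus ?case by (simp only: card.empty) simp
qed

lemma card_int_divisors_le:
  assumes "m > 0" shows "finite {d. nat \<bar>d\<bar> dvd m}" "card {d. nat \<bar>d\<bar> dvd m} \<le> 2 * num_divisors m"
proof -
  let ?f = "\<lambda>(s, d). if s then int d else - int d"
  have "{d. nat \<bar>d\<bar> dvd m} \<subseteq> ?f ` (UNIV \<times> {d. d dvd m})"
  proof
    fix d :: int assume d: "d \<in> {d. nat \<bar>d\<bar> dvd m}"
    have "d = ?f (d \<ge> 0, nat \<bar>d\<bar>)" by auto
    with d show "d \<in> ?f ` (UNIV \<times> {d. d dvd m})" by blast
  qed
  moreover have fin: "finite (UNIV \<times> {d. d dvd m} :: (bool \<times> nat) set)" using assms by simp
  ultimately show "finite {d. nat \<bar>d\<bar> dvd m}" by (meson finite_imageI finite_subset)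
  have "card {d. nat \<bar>d\<bar> dvd m} \<le> card (UNIV \<times> {d. d dvd m} :: (bool \<times> nat) set)"
    by (rule surj_card_le) fact+
  thus "card {d. nat \<bar>d\<bar> dvd m} \<le> 2 * num_divisors m" by (simp add: card_cartesian_product num_divisors_def)
qed

text \<open>Every entry is, up to sign, a divisor of the product, which leaves at most
  \<open>2 * num_divisors m\<close> choices for each.\<close>

lemma card_listset_prod_eq:
  assumes "m > 0"
  shows "card {ds \<in> listset Ds. nat \<bar>prod_list ds\<bar> = m} \<le> (2 * num_divisors m) ^ length Ds"
proof -
  let ?E = "{d. nat \<bar>d\<bar> dvd m}"
  have "{ds \<in> listset Ds. nat \<bar>prod_list ds\<bar> = m} \<subseteq> {ds. set ds \<subseteq> ?E \<and> length ds = length Ds}"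
  proof
    fix ds assume "ds \<in> {ds \<in> listset Ds. nat \<bar>prod_list ds\<bar> = m}"
    hence ds: "ds \<in> listset Ds" "nat \<bar>prod_list ds\<bar> = m" by auto
    have "nat \<bar>d\<bar> dvd m" if "d \<in> set ds" for d
      using prod_list_dvd[OF that] unfolding ds(2)[symmetric] by (simp add: nat_abs_dvd_iff)
    thus "ds \<in> {ds. set ds \<subseteq> ?E \<and> length ds = length Ds}" using listset_length[OF ds(1)] by auto
  qed
  hence "card {ds \<in> listset Ds. nat \<bar>prod_list ds\<bar> = m} \<le> card {ds. set ds \<subseteq> ?E \<and> length ds = length Ds}"
    using card_int_divisors_le(1)[OF assms] by (intro card_mono finite_lists_length_eq)
  also have "\<dots> = card ?E ^ length Ds" by (rule card_lists_length_eq[OF card_int_divisors_le(1)[OF assms]])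
  also have "\<dots> \<le> (2 * num_divisors m) ^ length Ds" by (intro power_mono card_int_divisors_le(2) assms) simp
  finally show ?thesis .
qed

text \<open>The averaged form of Weyl's estimate. Lists with product 0 receive the trivial weight
  \<open>Y\<close> and have proportion of order \<open>1 / L\<close>; a nonzero product of given
  absolute value has few representations by the divisor bound, which reduces the rest to a single
  sum over \<open>m\<close>. The premise \<open>0 \<in> D\<close> exempts the set of frequencies
  \<open>h\<close>, which may be shorter than \<open>Z\<close> but omits 0.\<close>

lemma avg_recip_weight_le:
  assumes "\<epsilon> > 0"
  obtains C :: real where "C > 0"
    "\<And>Ds (M::nat) L Y Z \<beta>. length Ds = n \<Longrightarrow> (\<And>D. D \<in> set Ds \<Longrightarrow> finite D) \<Longrightarrow>
      (\<And>D. D \<in> set Ds \<Longrightarrow> 0 \<in> D \<Longrightarrow> L \<le> real (card D)) \<Longrightarrow>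
      1 \<le> M \<Longrightarrow> (\<And>ds. ds \<in> listset Ds \<Longrightarrow> \<bar>prod_list ds\<bar> \<le> int M) \<Longrightarrow> M \<le> card (listset Ds) \<Longrightarrow>
      1 \<le> Z \<Longrightarrow> Z \<le> L \<Longrightarrow> Z \<le> Y \<Longrightarrow>
      (\<And>q::int. 1 \<le> q \<Longrightarrow> of_int q \<le> Z \<Longrightarrow> Z / (real M * Y) < nearest_int_dist (of_int q * \<beta>)) \<Longrightarrow>
      avg (listset Ds) (\<lambda>ds. recip_weight Y (\<beta> * of_int (prod_list ds))) \<le> C * real M powr \<epsilon> * (Y / Z)"
proof -
  \<comment> \<open>A power M^\<eta> arises \<open>n\<close> times from the divisor bound and once
    from the harmonic sum; the bound for \<open>harm\<close> asks for
    \<open>\<eta> <= 1\<close>.\<close>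
  define \<eta> where "\<eta> = min 1 (\<epsilon> / (real n + 1))"
  have "(real n + 1) * \<eta> \<le> (real n + 1) * (\<epsilon> / (real n + 1))"
    unfolding \<eta>_def by (intro mult_left_mono) auto
  hence \<eta>: "0 < \<eta>" "\<eta> \<le> 1" "(real n + 1) * \<eta> \<le> \<epsilon>"
    using assms by (auto simp: \<eta>_def)
  obtain B where B: "B \<ge> 1" "\<And>m. m > 0 \<Longrightarrow> real (num_divisors m) \<le> B * real m powr \<eta>"
    using divisor_bound[OF \<eta>(1)] by blast
  \<comment> \<open>\<open>n\<close> comes from the lists with product 0, \<open>(2 * B) ^ n\<close>
    from signs and divisors, 13 = 1 + 12 from \<open>recip_weight_sum_le\<close> with
    \<open>Y / Z >= 1\<close>, and \<open>4 / \<eta>\<close> from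
    \<open>harm (2 * M)\<close>.\<close>
  define C where "C = real n + (2 * B) ^ n * 13 * (4 / \<eta>)"
  have "C > 0" using \<eta> B by (simp add: C_def add_nonneg_pos)
  moreover have "avg (listset Ds) (\<lambda>ds. recip_weight Y (\<beta> * of_int (prod_list ds))) \<le> C * real M powr \<epsilon> * (Y / Z)"
    if len: "length Ds = n" and fin: "\<And>D. D \<in> set Ds \<Longrightarrow> finite D"
      and L: "\<And>D. D \<in> set Ds \<Longrightarrow> 0 \<in> D \<Longrightarrow> L \<le> real (card D)"
      and M: "1 \<le> M" and PM: "\<And>ds. ds \<in> listset Ds \<Longrightarrow> \<bar>prod_list ds\<bar> \<le> int M"
      and card: "M \<le> card (listset Ds)"
      and Z: "1 \<le> Z" "Z \<le> L" "Z \<le> Y"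
      and far: "\<And>q::int. 1 \<le> q \<Longrightarrow> of_int q \<le> Z \<Longrightarrow> Z / (real M * Y) < nearest_int_dist (of_int q * \<beta>)"
    for Ds :: "int set list" and M :: nat and L Y Z \<beta> :: real
  proof -
    define T where "T = listset Ds"
    define W where "W s = recip_weight Y (\<beta> * s)" for s
    have Y: "Y > 0" using Z by simp
    have finT: "finite T" unfolding T_def using fin by (rule finite_listset)
    have Tpos: "real (card T) > 0" using card M by (simp add: T_def)
    define T0 where "T0 = {ds \<in> T. prod_list ds = 0}"
    define T1 where "T1 = {ds \<in> T. prod_list ds \<noteq> 0}"
    have W0: "0 \<le> W s" "W s \<le> Y" for s
      by (simp_all add: W_def recip_weight_nonneg[OF Y] recip_weight_le[OF Y])
    have "real (card T0) * L \<le> real n * real (card T)"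
      unfolding T0_def T_def len[symmetric] using fin L Z by (intro card_listset_prod_zero) auto
    moreover have "real (card T0) * Z \<le> real (card T0) * L" using Z by (intro mult_left_mono) auto
    ultimately have cardT0: "real (card T0) \<le> real n * real (card T) / Z" using Z by (simp add: field_simps)
    have "(\<Sum>ds\<in>T0. W (of_int (prod_list ds))) \<le> (\<Sum>ds\<in>T0. Y)" by (intro sum_mono W0)
    also have "\<dots> \<le> (real n * real (card T) / Z) * Y" using mult_right_mono[OF cardT0, of Y] Y by simp
    finally have S0: "(\<Sum>ds\<in>T0. W (of_int (prod_list ds))) \<le> real (card T) * (real n * (Y / Z))" by (simp add: mult_ac)

    have harm: "harm (2 * M) \<le> 4 / \<eta> * real M powr \<eta>"
    proof -
      have "harm (2 * M) \<le> 2 / \<eta> * real (2 * M) powr \<eta>" by (rule harm_powr_bound) (use \<eta> M in auto)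
      also have "real (2 * M) powr \<eta> \<le> 2 * real M powr \<eta>"
      proof -
        have "(2::real) powr \<eta> \<le> 2 powr 1" using \<eta> by (intro powr_mono) auto
        thus ?thesis by (simp add: powr_mult mult_right_mono)
      qed
      finally have "harm (2 * M) \<le> 2 / \<eta> * (2 * real M powr \<eta>)" using \<eta> by (simp add: divide_right_mono)
      thus ?thesis by simp
    qed
    have fiber: "(\<Sum>ds\<in>{ds \<in> T1. nat \<bar>prod_list ds\<bar> = m}. W (of_int (prod_list ds))) \<le> (2 * B * real M powr \<eta>) ^ n * W (real m)"
      if m: "m \<in> {1..M}" for m
    proof -
      have "(\<Sum>ds\<in>{ds \<in> T1. nat \<bar>prod_list ds\<bar> = m}. W (of_int (prod_list ds)))
          = (\<Sum>ds\<in>{ds \<in> T1. nat \<bar>prod_list ds\<bar> = m}. W (real m))"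
      proof (rule sum.cong[OF refl])
        fix ds assume "ds \<in> {ds \<in> T1. nat \<bar>prod_list ds\<bar> = m}"
        hence "real m = \<bar>of_int (prod_list ds)\<bar>" by auto
        thus "W (of_int (prod_list ds)) = W (real m)" by (simp only: W_def recip_weight_abs)
      qed
      also have "\<dots> = real (card {ds \<in> T1. nat \<bar>prod_list ds\<bar> = m}) * W (real m)" by simp
      also have "\<dots> \<le> real ((2 * num_divisors m) ^ n) * W (real m)"
      proof (intro mult_right_mono W0)
        have "card {ds \<in> T1. nat \<bar>prod_list ds\<bar> = m} \<le> card {ds \<in> T. nat \<bar>prod_list ds\<bar> = m}"
          using finT by (intro card_mono) (auto simp: T1_def)
        also have "\<dots> \<le> (2 * num_divisors m) ^ n"
          unfolding T_def len[symmetric] using m by (intro card_listset_prod_eq) auto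
        finally show "real (card {ds \<in> T1. nat \<bar>prod_list ds\<bar> = m}) \<le> real ((2 * num_divisors m) ^ n)"
          by (simp only: of_nat_le_iff)
      qed
      also have "\<dots> \<le> (2 * B * real M powr \<eta>) ^ n * W (real m)"
      proof (intro mult_right_mono W0)
        have "real (num_divisors m) \<le> B * real m powr \<eta>" using m by (intro B) auto
        also have "\<dots> \<le> B * real M powr \<eta>" using m B \<eta> by (intro mult_left_mono powr_mono2) auto
        finally show "real ((2 * num_divisors m) ^ n) \<le> (2 * B * real M powr \<eta>) ^ n"
          unfolding of_nat_power by (intro power_mono) auto
      qed
      finally show ?thesis .
    qed
    have "(\<Sum>ds\<in>T1. W (of_int (prod_list ds))) = (\<Sum>m\<in>{1..M}. \<Sum>ds\<in>{ds \<in> T1. nat \<bar>prod_list ds\<bar> = m}. W (of_int (prod_list ds)))"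
    proof (rule sum.group[symmetric])
      show "(\<lambda>ds. nat \<bar>prod_list ds\<bar>) ` T1 \<subseteq> {1..M}"
      proof
        fix m assume "m \<in> (\<lambda>ds. nat \<bar>prod_list ds\<bar>) ` T1"
        then obtain ds where "m = nat \<bar>prod_list ds\<bar>" "ds \<in> T" "prod_list ds \<noteq> 0" by (auto simp: T1_def)
        with PM[of ds] show "m \<in> {1..M}" by (auto simp: T_def)
      qed
    qed (use finT in \<open>auto simp: T1_def\<close>)
    also have "\<dots> \<le> (\<Sum>m\<in>{1..M}. (2 * B * real M powr \<eta>) ^ n * W (real m))"
      by (intro sum_mono fiber)
    also have "\<dots> = (2 * B * real M powr \<eta>) ^ n * (\<Sum>m\<in>{1..M}. W (real m))" by (simp add: sum_distrib_left)
    also have "\<dots> \<le> (2 * B * real M powr \<eta>) ^ n * ((real M * Y / Z + 12 * real M) * harm (2 * M))"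
      unfolding W_def using B far Z M Y by (intro mult_left_mono recip_weight_sum_le) auto
    also have "\<dots> \<le> (2 * B * real M powr \<eta>) ^ n * ((13 * real M * (Y / Z)) * (4 / \<eta> * real M powr \<eta>))"
    proof (intro mult_left_mono mult_mono harm)
      have "1 \<le> Y / Z" using Z by simp
      hence "12 * real M * 1 \<le> 12 * real M * (Y / Z)" by (intro mult_left_mono) auto
      moreover have "13 * real M * (Y / Z) = real M * Y / Z + 12 * real M * (Y / Z)" by (simp add: field_simps)
      ultimately show "real M * Y / Z + 12 * real M \<le> 13 * real M * (Y / Z)" by linarith
    qed (use B Y Z \<eta> in \<open>auto simp: harm_nonneg\<close>)
    also have "\<dots> = real M * ((2 * B) ^ n * 13 * (4 / \<eta>) * (real M powr \<eta>) ^ Suc n * (Y / Z))"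
      by (simp add: power_mult_distrib mult_ac)
    also have "\<dots> \<le> real (card T) * ((2 * B) ^ n * 13 * (4 / \<eta>) * real M powr \<epsilon> * (Y / Z))"
    proof (intro mult_mono mult_right_mono mult_left_mono)
      have "(real M powr \<eta>) ^ Suc n = real M powr ((real n + 1) * \<eta>)"
        using M by (simp add: powr_realpow[symmetric] powr_powr powr_add[symmetric] algebra_simps del: power_Suc)
      also have "\<dots> \<le> real M powr \<epsilon>" using M \<eta> by (intro powr_mono) auto
      finally show "(real M powr \<eta>) ^ Suc n \<le> real M powr \<epsilon>" .
    qed (use B Y Z \<eta> card in \<open>auto simp: T_def\<close>)
    finally have S1: "(\<Sum>ds\<in>T1. W (of_int (prod_list ds))) \<le> real (card T) * ((2 * B) ^ n * 13 * (4 / \<eta>) * real M powr \<epsilon> * (Y / Z))" .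
    have "T = T0 \<union> T1" "T0 \<inter> T1 = {}" by (auto simp: T0_def T1_def)
    hence "(\<Sum>ds\<in>T. W (of_int (prod_list ds))) = (\<Sum>ds\<in>T0. W (of_int (prod_list ds))) + (\<Sum>ds\<in>T1. W (of_int (prod_list ds)))"
      by (metis (no_types, lifting) finT finite_Un sum.union_disjoint)
    also have "\<dots> \<le> real (card T) * (real n * (Y / Z)) + real (card T) * ((2 * B) ^ n * 13 * (4 / \<eta>) * real M powr \<epsilon> * (Y / Z))"
      by (intro add_mono S0 S1)
    finally have "avg T (\<lambda>ds. W (of_int (prod_list ds))) \<le> real n * (Y / Z) + (2 * B) ^ n * 13 * (4 / \<eta>) * real M powr \<epsilon> * (Y / Z)"
      using Tpos by (simp add: avg_def divide_le_eq distrib_right distrib_left mult.commute)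
    also have "real n * (Y / Z) \<le> real n * real M powr \<epsilon> * (Y / Z)"
    proof -
      have "1 \<le> real M powr \<epsilon>" using M assms by (intro ge_one_powr_ge_zero) auto
      thus ?thesis using Y Z by (intro mult_right_mono) (auto simp: mult_left_le mult_le_cancel_left1)
    qed
    finally show ?thesis unfolding W_def T_def C_def distrib_right by simp
  qed
  ultimately show ?thesis using that by blast
qed

section \<open>The alternative for a gap form\<close>

text \<open>Lets the number of lists serve as the bound for their products as well, so that it can
  be taken as \<open>M\<close> in \<open>avg_recip_weight_le\<close>.\<close>

lemma abs_prod_list_le_card:
  assumes "\<And>D d. D \<in> set Ds \<Longrightarrow> d \<in> D \<Longrightarrow> \<bar>d\<bar> \<le> int (card D)" "ds \<in> listset Ds"
  shows "\<bar>prod_list ds\<bar> \<le> int (card (listset Ds))"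
  using assms
proof (induction Ds arbitrary: ds)
  case (Cons D Ds)
  then obtain d es where ds: "ds = d # es" "d \<in> D" "es \<in> listset Ds" by (auto simp: set_Cons_def)
  have "\<bar>d\<bar> * \<bar>prod_list es\<bar> \<le> int (card D) * int (card (listset Ds))"
    using Cons.prems(1)[of D d] Cons.IH[OF _ ds(3)] Cons.prems(1) ds(2) by (intro mult_mono) auto
  thus ?case by (simp add: ds(1) abs_mult card_listset del: listset.simps)
qed simp

text \<open>Once the differenced phase is linear, the inner sum over an interval is geometric. The
  two-variable differencing is specialised by a one-point second variable.\<close>

lemma weyl_differencing_power:
  fixes f :: "int \<Rightarrow> real" and a b :: int
  assumes Y: "Y > 0" and A: "A = {a..b}" "real (card A) \<le> Y"
    and D: "finite D" "D \<noteq> {}" "\<And>x x'. x \<in> A \<Longrightarrow> x' \<in> A \<Longrightarrow> x' - x \<in> D"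
    and lin: "\<And>es. length es = n \<Longrightarrow> \<exists>c. \<forall>x. diffs es f x = \<beta> * of_int (prod_list es) * of_int x + c"
  shows "(norm (\<Sum>x\<in>A. unit_exp (f x)) / real (card D)) ^ (2 ^ n)
    \<le> avg (listset (replicate n D)) (\<lambda>es. recip_weight Y (\<beta> * of_int (prod_list es)) / real (card D))"
proof -
  have "(norm (\<Sum>x\<in>A. \<Sum>y\<in>{()}. unit_exp (f x)) / (real (card {()}) * real (card D))) ^ (2 ^ n)
    \<le> avg (listset (replicate n D)) (\<lambda>ds. norm (\<Sum>x\<in>shift_inter ds A. \<Sum>y\<in>{()}.
          unit_exp (diffs ds (\<lambda>x. f x) x)) / (real (card {()}) * real (card D)))"
    using A D by (intro weyl_differencing) auto
  hence "(norm (\<Sum>x\<in>A. unit_exp (f x)) / real (card D)) ^ (2 ^ n)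
    \<le> avg (listset (replicate n D)) (\<lambda>ds. norm (\<Sum>x\<in>shift_inter ds A. unit_exp (diffs ds f x)) / real (card D))"
    by simp
  also have "\<dots> \<le> avg (listset (replicate n D)) (\<lambda>es. recip_weight Y (\<beta> * of_int (prod_list es)) / real (card D))"
  proof (intro avg_mono divide_right_mono)
    fix es assume "es \<in> listset (replicate n D)"
    hence "length es = n" using listset_length by fastforce
    from lin[OF this] obtain c where c: "\<And>x. diffs es f x = \<beta> * of_int (prod_list es) * of_int x + c" by blast
    obtain a' b' where ab: "shift_inter es A = {a'..b'}" using shift_inter_interval A(1) by blast
    have "card (shift_inter es A) \<le> card A" using A(1) by (intro card_mono shift_inter_subset) auto
    hence "real (card {a'..b'}) \<le> Y" using A(2) unfolding ab by linarith
    from unit_exp_sum_le_weight[OF this Y]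
    show "norm (\<Sum>x\<in>shift_inter es A. unit_exp (diffs es f x)) \<le> recip_weight Y (\<beta> * of_int (prod_list es))"
      unfolding ab c .
  qed simp
  finally show ?thesis .
qed

text \<open>
  Differencing \<open>j\<close> times in \<open>x\<close> removes every term \<open>x\<^sup>i y\<^bsup>k-i\<^esup>\<close> with \<open>i < j\<close> and leaves
  \<open>x\<^sup>j y\<^bsup>k-j\<^esup>\<close> independent of \<open>x\<close>, so that the double sum factors.
\<close>

lemma gap_form_sum_factors:
  assumes len: "length ds = j"
  shows "norm (\<Sum>x\<in>A. \<Sum>y\<in>B. unit_exp (diffs ds (\<lambda>x. of_int h * gap_form k j \<alpha> x y) x))
    = norm (\<Sum>x\<in>A. unit_exp (diffs ds (\<lambda>x. of_int h * \<alpha> k * of_int x ^ k) x))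
      * norm (\<Sum>y\<in>B. unit_exp (fact j * \<alpha> j * of_int (prod_list (h # ds)) * of_int y ^ (k - j)))"
proof -
  have "diffs ds (\<lambda>x. of_int h * gap_form k j \<alpha> x y) x
      = diffs ds (\<lambda>x. of_int h * \<alpha> k * of_int x ^ k) x + fact j * \<alpha> j * of_int (prod_list (h # ds)) * of_int y ^ (k - j)"
    for x y
  proof -
    let ?c = "\<lambda>i. of_int h * \<alpha> i * of_int y ^ (k - i)"
    have "(\<lambda>x. of_int h * gap_form k j \<alpha> x y)
        = (\<lambda>x. of_int h * \<alpha> k * of_int x ^ k + (\<Sum>i\<le>length ds. ?c i * of_int x ^ i))"
      by (simp add: gap_form_def len fun_eq_iff distrib_left sum_distrib_left atLeast0AtMost mult_ac)
    hence "diffs ds (\<lambda>x. of_int h * gap_form k j \<alpha> x y) x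
        = diffs ds (\<lambda>x. of_int h * \<alpha> k * of_int x ^ k) x + diffs ds (\<lambda>x. \<Sum>i\<le>length ds. ?c i * of_int x ^ i) x"
      by (simp only: diffs_add)
    thus ?thesis unfolding diffs_power_const by (simp add: len mult_ac)
  qed
  thus ?thesis by (simp add: unit_exp_add norm_mult flip: sum_product)
qed

text \<open>After \<open>j\<close> differencings the sum factors, and Cauchy's inequality over the
  lists (h, d_1, ..., d_j) separates the factors. Each is then differenced \<open>k - j - 1\<close>
  more times, until its phase is linear. Both end as averages over lists of length \<open>k\<close>,
  and \<open>M1\<close> and \<open>M2\<close> are the numbers of these lists.\<close>

lemma gap_form_step:
  fixes k j :: nat
  assumes \<epsilon>: "\<epsilon> > 0" and jk: "j + 2 \<le> k"
  obtains C :: real where "C > 0"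
    "\<And>N P H Z1 Z2 \<alpha> M1 M2. N \<ge> 1 \<Longrightarrow> P \<ge> 1 \<Longrightarrow> H \<ge> 1 \<Longrightarrow>
      M1 = 2 * H * (2 * N + 1) ^ (k - 1) \<Longrightarrow> M2 = 2 * H * (2 * N + 1) ^ j * (2 * P + 1) ^ (k - j - 1) \<Longrightarrow>
      P \<le> N \<Longrightarrow> 1 \<le> Z1 \<Longrightarrow> Z1 \<le> real N \<Longrightarrow> 1 \<le> Z2 \<Longrightarrow> Z2 \<le> real P \<Longrightarrow>
      (\<And>q::int. 1 \<le> q \<Longrightarrow> of_int q \<le> Z1 \<Longrightarrow> Z1 / (real M1 * real N) < nearest_int_dist (of_int q * (fact k * \<alpha> k))) \<Longrightarrow>
      (\<And>q::int. 1 \<le> q \<Longrightarrow> of_int q \<le> Z2 \<Longrightarrow> Z2 / (real M2 * real P) < nearest_int_dist (of_int q * (fact j * fact (k - j) * \<alpha> j))) \<Longrightarrow>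
      (\<And>x y. x \<in> {1..int N} \<Longrightarrow> y \<in> {1..int P} \<Longrightarrow> 1 / real H \<le> nearest_int_dist (gap_form k j \<alpha> x y)) \<Longrightarrow>
      Z1 * Z2 \<le> C * (real M1 powr \<epsilon> * real M2 powr \<epsilon>) * real H ^ (2 ^ (k - 1))"
proof -
  define n where "n = k - j - 1"
  have n: "n \<ge> 1" "j + n + 1 = k" "k - j = n + 1" using jk by (auto simp: n_def)
  obtain C0 where C0: "C0 > 0"
    "\<And>Ds (M::nat) L Y Z \<beta>. length Ds = k \<Longrightarrow> (\<And>D. D \<in> set Ds \<Longrightarrow> finite D) \<Longrightarrow>
      (\<And>D. D \<in> set Ds \<Longrightarrow> 0 \<in> D \<Longrightarrow> L \<le> real (card D)) \<Longrightarrow>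
      1 \<le> M \<Longrightarrow> (\<And>ds. ds \<in> listset Ds \<Longrightarrow> \<bar>prod_list ds\<bar> \<le> int M) \<Longrightarrow> M \<le> card (listset Ds) \<Longrightarrow>
      1 \<le> Z \<Longrightarrow> Z \<le> L \<Longrightarrow> Z \<le> Y \<Longrightarrow>
      (\<And>q::int. 1 \<le> q \<Longrightarrow> of_int q \<le> Z \<Longrightarrow> Z / (real M * Y) < nearest_int_dist (of_int q * \<beta>)) \<Longrightarrow>
      avg (listset Ds) (\<lambda>ds. recip_weight Y (\<beta> * of_int (prod_list ds))) \<le> C0 * real M powr \<epsilon> * (Y / Z)"
    using avg_recip_weight_le[OF \<epsilon>, of k] by metis
  \<comment> \<open>36 = 6 * 2 * 3: the detection constant, the \<open>2 H\<close> frequencies, and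
    \<open>card D1 <= 3 N\<close>. The factor \<open>3 ^ (2 ^ n)\<close> appears because
    \<open>V\<close> is divided by \<open>P\<close> whereas its differencing is normalised by
    \<open>card D2 <= 3 P\<close>.\<close>
  define C where "C = 36 ^ (2 ^ (k - 1)) * (C0 * (3 ^ (2 ^ n) * C0))"
  have "C > 0" using C0 by (simp add: C_def)
  have claim: "Z1 * Z2 \<le> C * (real M1 powr \<epsilon> * real M2 powr \<epsilon>) * real H ^ (2 ^ (k - 1))"
    if N: "N \<ge> 1" and P: "P \<ge> 1" and H: "H \<ge> 1"
      and M1: "M1 = 2 * H * (2 * N + 1) ^ (k - 1)" and M2: "M2 = 2 * H * (2 * N + 1) ^ j * (2 * P + 1) ^ (k - j - 1)"
      and PN: "P \<le> N" and Z1: "1 \<le> Z1" "Z1 \<le> real N" and Z2: "1 \<le> Z2" "Z2 \<le> real P"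
      and far1: "\<And>q::int. 1 \<le> q \<Longrightarrow> of_int q \<le> Z1 \<Longrightarrow> Z1 / (real M1 * real N) < nearest_int_dist (of_int q * (fact k * \<alpha> k))"
      and far2: "\<And>q::int. 1 \<le> q \<Longrightarrow> of_int q \<le> Z2 \<Longrightarrow> Z2 / (real M2 * real P) < nearest_int_dist (of_int q * (fact j * fact (k - j) * \<alpha> j))"
      and gap: "\<And>x y. x \<in> {1..int N} \<Longrightarrow> y \<in> {1..int P} \<Longrightarrow> 1 / real H \<le> nearest_int_dist (gap_form k j \<alpha> x y)"
    for N P H M1 M2 :: nat and Z1 Z2 :: real and \<alpha> :: "nat \<Rightarrow> real"
  proof -
    define A where "A = {1..int N}"
    define B where "B = {1..int P}"
    define D1 where "D1 = {-int N..int N}"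
    define D2 where "D2 = {-int P..int P}"
    define Hs where "Hs = {1..2 * int H}"
    define T where "T = listset (Hs # replicate j D1)"
    define S where "S h = norm (\<Sum>x\<in>A. \<Sum>y\<in>B. unit_exp (of_int h * gap_form k j \<alpha> x y))" for h :: int
    \<comment> \<open>The head of \<open>hs\<close> is the frequency and its tail the differences;
      in one list they enter the phases that finally become linear only through their
      product.\<close>
    define U where "U hs = norm (\<Sum>x\<in>shift_inter (tl hs) A. unit_exp (diffs (tl hs) (\<lambda>x. of_int (hd hs) * \<alpha> k * of_int x ^ k) x)) / real (card D1)" for hs :: "int list"
    define V where "V hs = norm (\<Sum>y\<in>B. unit_exp (fact j * \<alpha> j * of_int (prod_list hs) * of_int y ^ (k - j))) / real P" for hs
    have card: "card A = N" "card B = P" "card D1 = 2 * N + 1" "card D2 = 2 * P + 1" "card Hs = 2 * H"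
      by (simp_all add: A_def B_def D1_def D2_def Hs_def)
    have D1: "finite D1" "D1 \<noteq> {}" "x \<in> A \<Longrightarrow> x' \<in> A \<Longrightarrow> x' - x \<in> D1" for x x'
      by (auto simp: A_def D1_def)
    have D2: "finite D2" "D2 \<noteq> {}" "x \<in> B \<Longrightarrow> x' \<in> B \<Longrightarrow> x' - x \<in> D2" for x x'
      by (auto simp: B_def D2_def)

    have "1 / (36 * real H) \<le> avg Hs (\<lambda>h. S h / (real P * real (card D1)))"
    proof -
      have "real (card (A \<times> B)) \<le> 6 * (\<Sum>t\<in>Hs. norm (\<Sum>z\<in>A \<times> B. unit_exp (of_int t * (case z of (x, y) \<Rightarrow> gap_form k j \<alpha> x y))))"
        unfolding Hs_def
        by (rule exponential_sums_detect_gap[OF H]) (use gap in \<open>auto simp: A_def B_def\<close>)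
      also have "(\<Sum>t\<in>Hs. norm (\<Sum>z\<in>A \<times> B. unit_exp (of_int t * (case z of (x, y) \<Rightarrow> gap_form k j \<alpha> x y)))) = (\<Sum>t\<in>Hs. S t)"
        unfolding S_def by (simp add: sum.cartesian_product case_prod_beta)
      finally have "real N * real P \<le> 6 * (\<Sum>t\<in>Hs. S t)" by (simp add: card_cartesian_product card)
      moreover have "real (card D1) \<le> 3 * real N" using N by (simp add: card)
      hence "real P * real (card D1) \<le> 3 * (real N * real P)" using mult_left_mono[of "real (card D1)" "3 * real N" "real P"] by (simp add: mult_ac)
      ultimately have "real P * real (card D1) / 18 \<le> (\<Sum>t\<in>Hs. S t)" by simp
      hence "real P * real (card D1) / 18 / (real P * real (card D1)) / real (card Hs) \<le> (\<Sum>t\<in>Hs. S t) / (real P * real (card D1)) / real (card Hs)"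
        by (intro divide_right_mono) auto
      moreover have "real P * real (card D1) / 18 / (real P * real (card D1)) / real (card Hs) = 1 / (36 * real H)"
        using P by (simp add: card)
      ultimately have "1 / (36 * real H) \<le> (\<Sum>t\<in>Hs. S t) / (real P * real (card D1)) / real (card Hs)" by simp
      thus ?thesis by (simp add: avg_def sum_divide_distrib)
    qed
    hence "(1 / (36 * real H)) ^ (2 ^ j) \<le> avg Hs (\<lambda>h. S h / (real P * real (card D1))) ^ (2 ^ j)"
      by (intro power_mono) auto
    also have "\<dots> \<le> avg Hs (\<lambda>h. (S h / (real P * real (card D1))) ^ (2 ^ j))"
      by (intro avg_power_le) (simp add: S_def)
    also have "\<dots> \<le> avg Hs (\<lambda>h. avg (listset (replicate j D1)) (\<lambda>ds. U (h # ds) * V (h # ds)))"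
    proof (intro avg_mono)
      fix h assume "h \<in> Hs"
      have "(S h / (real P * real (card D1))) ^ (2 ^ j) \<le> avg (listset (replicate j D1)) (\<lambda>ds. norm (\<Sum>x\<in>shift_inter ds A. \<Sum>y\<in>B.
          unit_exp (diffs ds (\<lambda>x. of_int h * gap_form k j \<alpha> x y) x)) / (real P * real (card D1)))"
        unfolding S_def card(2)[symmetric] by (rule weyl_differencing) (use D1 in \<open>auto simp: A_def\<close>)
      also have "\<dots> = avg (listset (replicate j D1)) (\<lambda>ds. U (h # ds) * V (h # ds))"
      proof (rule avg_cong)
        fix ds assume "ds \<in> listset (replicate j D1)"
        hence "length ds = j" using listset_length by fastforce
        from gap_form_sum_factors[OF this]
        show "norm (\<Sum>x\<in>shift_inter ds A. \<Sum>y\<in>B. unit_exp (diffs ds (\<lambda>x. of_int h * gap_form k j \<alpha> x y) x)) / (real P * real (card D1))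
            = U (h # ds) * V (h # ds)"
          by (simp add: U_def V_def)
      qed
      finally show "(S h / (real P * real (card D1))) ^ (2 ^ j) \<le> avg (listset (replicate j D1)) (\<lambda>ds. U (h # ds) * V (h # ds))" .
    qed
    also have "\<dots> = avg T (\<lambda>hs. U hs * V hs)" unfolding T_def avg_listset_Cons ..
    finally have UV: "(1 / (36 * real H)) ^ (2 ^ j) \<le> avg T (\<lambda>hs. U hs * V hs)" .
    \<comment> \<open>The two rounds combine because \<open>j + n = k - 1\<close>.\<close>
    have "(1 / (36 * real H)) ^ (2 ^ (k - 1)) = ((1 / (36 * real H)) ^ (2 ^ j)) ^ (2 ^ n)"
      unfolding power_mult[symmetric] power_add[symmetric] using n(2) by (metis add_diff_cancel_right')
    also have "\<dots> \<le> avg T (\<lambda>hs. U hs * V hs) ^ (2 ^ n)" by (intro power_mono UV) simp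
    also have "\<dots> \<le> avg T (\<lambda>hs. U hs ^ (2 ^ n)) * avg T (\<lambda>hs. V hs ^ (2 ^ n))"
      by (rule avg_mult_power_le[OF n(1)])
    finally have main: "(1 / (36 * real H)) ^ (2 ^ (k - 1)) \<le> avg T (\<lambda>hs. U hs ^ (2 ^ n)) * avg T (\<lambda>hs. V hs ^ (2 ^ n))" .

    have dom: "\<bar>d\<bar> \<le> int (card D)" if "D = Hs \<or> D = D1 \<or> D = D2" "d \<in> D" for D d
      using that card by (auto simp: Hs_def D1_def D2_def)
    have fin: "finite Hs" "finite D1" "finite D2" and zero: "0 \<notin> Hs"
      by (auto simp: Hs_def D1_def D2_def)
    have length_T: "length hs = j + 1" if "hs \<in> T" for hs
      using listset_length[of hs "Hs # replicate j D1"] that by (simp add: T_def del: listset.simps)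

    have "avg T (\<lambda>hs. U hs ^ (2 ^ n)) \<le> avg T (\<lambda>hs. avg (listset (replicate n D1)) (\<lambda>es.
        recip_weight (real N) (fact k * \<alpha> k * of_int (prod_list (hs @ es))) / real (card D1)))"
    proof (rule avg_mono)
      fix hs assume "hs \<in> T"
      from length_T[OF this] obtain h ds where hs: "hs = h # ds" "length ds = j" by (cases hs) auto
      obtain a b where ab: "shift_inter ds A = {a..b}" using shift_inter_interval unfolding A_def by blast
      have sub: "shift_inter ds A \<subseteq> A" by (rule shift_inter_subset)
      have "(norm (\<Sum>x\<in>shift_inter ds A. unit_exp (diffs ds (\<lambda>x. of_int h * \<alpha> k * of_int x ^ k) x)) / real (card D1)) ^ (2 ^ n)
        \<le> avg (listset (replicate n D1)) (\<lambda>es. recip_weight (real N) ((fact k * \<alpha> k * of_int (prod_list hs)) * of_int (prod_list es)) / real (card D1))"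
      proof (rule weyl_differencing_power[OF _ ab])
        have "card (shift_inter ds A) \<le> card A" by (rule card_mono[OF _ sub]) (simp add: A_def)
        thus "real (card (shift_inter ds A)) \<le> real N" by (simp add: card)
        show "x' - x \<in> D1" if "x \<in> shift_inter ds A" "x' \<in> shift_inter ds A" for x x'
          using D1(3) sub that by blast
        fix es :: "int list" assume "length es = n"
        hence len: "length (ds @ es) + 1 = k" using hs n by simp
        from diffs_power_linear[of "ds @ es" "of_int h * \<alpha> k", unfolded len]
        show "\<exists>c. \<forall>x. diffs es (diffs ds (\<lambda>x. of_int h * \<alpha> k * of_int x ^ k)) x
            = fact k * \<alpha> k * of_int (prod_list hs) * of_int (prod_list es) * of_int x + c"
          by (simp add: diffs_append hs mult_ac)
      qed (use N D1 in auto)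
      thus "U hs ^ (2 ^ n) \<le> avg (listset (replicate n D1)) (\<lambda>es.
          recip_weight (real N) (fact k * \<alpha> k * of_int (prod_list (hs @ es))) / real (card D1))"
        by (simp add: U_def hs mult_ac)
    qed
    also have "\<dots> = (1 / real (card D1)) * avg (listset ((Hs # replicate j D1) @ replicate n D1)) (\<lambda>ds. recip_weight (real N) (fact k * \<alpha> k * of_int (prod_list ds)))"
      unfolding avg_listset_append T_def[symmetric] avg_cmult[symmetric] by simp
    also have "\<dots> \<le> (1 / real (card D1)) * (C0 * real M1 powr \<epsilon> * (real N / Z1))"
    proof (intro mult_left_mono C0(2)[where L = "real N"])
      have mem: "D = Hs \<or> D = D1 \<or> D = D1" if "D \<in> set ((Hs # replicate j D1) @ replicate n D1)" for D
        using that by (auto split: if_splits)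
      have "card (listset ((Hs # replicate j D1) @ replicate n D1)) = M1"
        using n(2)[symmetric] by (simp add: card_listset prod_list_replicate card M1 power_add del: listset.simps)
      note cM = this
      show "M1 \<le> card (listset ((Hs # replicate j D1) @ replicate n D1))" unfolding cM by simp
      show "\<bar>prod_list ds\<bar> \<le> int M1" if ds: "ds \<in> listset ((Hs # replicate j D1) @ replicate n D1)" for ds
        unfolding cM[symmetric]
      proof (rule abs_prod_list_le_card[OF _ ds])
        show "\<bar>d\<bar> \<le> int (card D)" if "D \<in> set ((Hs # replicate j D1) @ replicate n D1)" "d \<in> D" for D d
          using dom[OF _ that(2)] mem[OF that(1)] by blast
      qed
      show "finite D" if "D \<in> set ((Hs # replicate j D1) @ replicate n D1)" for D
        using mem[OF that] fin by auto
      show "real N \<le> real (card D)" if "D \<in> set ((Hs # replicate j D1) @ replicate n D1)" "0 \<in> D" for D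
        using mem[OF that(1)] that(2) PN zero by (auto simp: card)
      show "length ((Hs # replicate j D1) @ replicate n D1) = k" using n(2) by simp
      show "1 \<le> M1" using H by (simp add: M1)
    qed (use Z1 far1 C0(1) in auto)
    also have "\<dots> \<le> C0 * real M1 powr \<epsilon> / Z1"
    proof -
      have "real N / real (card D1) \<le> 1" by (simp add: card)
      hence "(C0 * real M1 powr \<epsilon> / Z1) * (real N / real (card D1)) \<le> (C0 * real M1 powr \<epsilon> / Z1) * 1"
        using C0 Z1 by (intro mult_left_mono) auto
      thus ?thesis by (simp add: mult_ac)
    qed
    finally have Ub: "avg T (\<lambda>hs. U hs ^ (2 ^ n)) \<le> C0 * real M1 powr \<epsilon> / Z1" .

    have "avg T (\<lambda>hs. V hs ^ (2 ^ n)) \<le> avg T (\<lambda>hs. 3 ^ (2 ^ n) * avg (listset (replicate n D2)) (\<lambda>es.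
        recip_weight (real P) (fact j * fact (k - j) * \<alpha> j * of_int (prod_list (hs @ es))) / real (card D2)))"
    proof (rule avg_mono)
      fix hs assume "hs \<in> T"
      let ?f = "\<lambda>y. fact j * \<alpha> j * of_int (prod_list hs) * of_int y ^ (k - j)"
      have "(norm (\<Sum>y\<in>B. unit_exp (?f y)) / real (card D2)) ^ (2 ^ n)
        \<le> avg (listset (replicate n D2)) (\<lambda>es. recip_weight (real P) ((fact j * fact (k - j) * \<alpha> j * of_int (prod_list hs)) * of_int (prod_list es)) / real (card D2))"
      proof (rule weyl_differencing_power[OF _ B_def])
        fix es :: "int list" assume "length es = n"
        hence len: "length es + 1 = k - j" using n(3) by simp
        from diffs_power_linear[of es "fact j * \<alpha> j * of_int (prod_list hs)", unfolded len]
        show "\<exists>c. \<forall>x. diffs es ?f x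
            = fact j * fact (k - j) * \<alpha> j * of_int (prod_list hs) * of_int (prod_list es) * of_int x + c"
          by (simp add: mult_ac)
      qed (use P D2 card in auto)
      moreover have "V hs ^ (2 ^ n) \<le> (3 * (norm (\<Sum>y\<in>B. unit_exp (?f y)) / real (card D2))) ^ (2 ^ n)"
      proof (rule power_mono)
        have "real (card D2) \<le> 3 * real P" using P by (simp add: card)
        hence "norm (\<Sum>y\<in>B. unit_exp (?f y)) * real (card D2) \<le> norm (\<Sum>y\<in>B. unit_exp (?f y)) * (3 * real P)"
          by (intro mult_left_mono) auto
        thus "V hs \<le> 3 * (norm (\<Sum>y\<in>B. unit_exp (?f y)) / real (card D2))"
          unfolding V_def using P by (simp add: card field_simps)
      qed (simp add: V_def)
      ultimately show "V hs ^ (2 ^ n) \<le> 3 ^ (2 ^ n) * avg (listset (replicate n D2)) (\<lambda>es.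
          recip_weight (real P) (fact j * fact (k - j) * \<alpha> j * of_int (prod_list (hs @ es))) / real (card D2))"
        unfolding power_mult_distrib by (simp add: mult.assoc) (smt (verit) mult_left_mono zero_le_power)
    qed
    also have "\<dots> = 3 ^ (2 ^ n) * ((1 / real (card D2)) * avg (listset ((Hs # replicate j D1) @ replicate n D2)) (\<lambda>ds. recip_weight (real P) (fact j * fact (k - j) * \<alpha> j * of_int (prod_list ds))))"
      unfolding avg_listset_append T_def[symmetric] avg_cmult[symmetric] by simp
    also have "\<dots> \<le> 3 ^ (2 ^ n) * ((1 / real (card D2)) * (C0 * real M2 powr \<epsilon> * (real P / Z2)))"
    proof (intro mult_left_mono C0(2)[where L = "real P"])
      have mem: "D = Hs \<or> D = D1 \<or> D = D2" if "D \<in> set ((Hs # replicate j D1) @ replicate n D2)" for D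
        using that by (auto split: if_splits)
      have "card (listset ((Hs # replicate j D1) @ replicate n D2)) = M2"
        by (simp add: card_listset prod_list_replicate card M2 n_def del: listset.simps)
      note cM = this
      show "M2 \<le> card (listset ((Hs # replicate j D1) @ replicate n D2))" unfolding cM by simp
      show "\<bar>prod_list ds\<bar> \<le> int M2" if ds: "ds \<in> listset ((Hs # replicate j D1) @ replicate n D2)" for ds
        unfolding cM[symmetric]
      proof (rule abs_prod_list_le_card[OF _ ds])
        show "\<bar>d\<bar> \<le> int (card D)" if "D \<in> set ((Hs # replicate j D1) @ replicate n D2)" "d \<in> D" for D d
          using dom[OF _ that(2)] mem[OF that(1)] by blast
      qed
      show "finite D" if "D \<in> set ((Hs # replicate j D1) @ replicate n D2)" for D
        using mem[OF that] fin by auto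
      show "real P \<le> real (card D)" if "D \<in> set ((Hs # replicate j D1) @ replicate n D2)" "0 \<in> D" for D
        using mem[OF that(1)] that(2) PN zero by (auto simp: card)
      show "length ((Hs # replicate j D1) @ replicate n D2) = k" using n(2) by simp
      show "1 \<le> M2" using H by (simp add: M2)
    qed (use Z2 far2 C0(1) in auto)
    also have "\<dots> \<le> 3 ^ (2 ^ n) * (C0 * real M2 powr \<epsilon> / Z2)"
    proof (rule mult_left_mono)
      have "real P / real (card D2) \<le> 1" by (simp add: card)
      hence "(C0 * real M2 powr \<epsilon> / Z2) * (real P / real (card D2)) \<le> (C0 * real M2 powr \<epsilon> / Z2) * 1"
        using C0 Z2 by (intro mult_left_mono) auto
      thus "(1 / real (card D2)) * (C0 * real M2 powr \<epsilon> * (real P / Z2)) \<le> C0 * real M2 powr \<epsilon> / Z2" by (simp add: mult_ac)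
    qed simp
    finally have Vb: "avg T (\<lambda>hs. V hs ^ (2 ^ n)) \<le> 3 ^ (2 ^ n) * (C0 * real M2 powr \<epsilon> / Z2)" .

    have "1 / (36 ^ (2 ^ (k - 1)) * real H ^ (2 ^ (k - 1))) = (1 / (36 * real H)) ^ (2 ^ (k - 1))"
      by (simp add: power_divide power_mult_distrib)
    also note main
    also have "avg T (\<lambda>hs. U hs ^ (2 ^ n)) * avg T (\<lambda>hs. V hs ^ (2 ^ n))
        \<le> (C0 * real M1 powr \<epsilon> / Z1) * (3 ^ (2 ^ n) * (C0 * real M2 powr \<epsilon> / Z2))"
      using C0 Z1 by (intro mult_mono Ub Vb avg_nonneg) (auto simp: V_def)
    also have "\<dots> = (C0 * (3 ^ (2 ^ n) * C0) * (real M1 powr \<epsilon> * real M2 powr \<epsilon>)) / (Z1 * Z2)"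
      by (simp add: mult_ac)
    finally have fin: "1 / (36 ^ (2 ^ (k - 1)) * real H ^ (2 ^ (k - 1)))
        \<le> (C0 * (3 ^ (2 ^ n) * C0) * (real M1 powr \<epsilon> * real M2 powr \<epsilon>)) / (Z1 * Z2)" .
    have "Z1 * Z2 \<le> R * Q" if "1 / Q \<le> R / (Z1 * Z2)" "Q > 0" for R Q :: real
      using that Z1 Z2 by (simp add: divide_le_eq le_divide_eq mult_ac)
    moreover have "(36 ^ (2 ^ (k - 1)) * real H ^ (2 ^ (k - 1))) > 0" using H by (intro mult_pos_pos zero_less_power) auto
    ultimately have "Z1 * Z2 \<le> (C0 * (3 ^ (2 ^ n) * C0) * (real M1 powr \<epsilon> * real M2 powr \<epsilon>))
        * (36 ^ (2 ^ (k - 1)) * real H ^ (2 ^ (k - 1)))"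
      using fin by blast
    also have "\<dots> = C * (real M1 powr \<epsilon> * real M2 powr \<epsilon>) * real H ^ (2 ^ (k - 1))"
    proof -
      have "c * m * (u * v) = u * c * m * v" for c m u v :: real by simp
      thus ?thesis unfolding C_def .
    qed
    finally show ?thesis .
  qed
  show ?thesis by (rule that[OF \<open>C > 0\<close>], rule claim)
qed

section \<open>Small values of gap forms\<close>

lemma nearest_int_dist_scaled:
  assumes "\<bar>of_int m\<bar> \<le> u" "nearest_int_dist \<theta> \<le> v"
  shows "nearest_int_dist (of_int m * \<theta>) \<le> u * v"
  using nearest_int_dist_mult[of m \<theta>] mult_mono[OF assms] assms(1) abs_ge_zero[of "real_of_int m"]
  by (meson nearest_int_dist_nonneg order_trans)

lemma nearest_int_dist_power_le:
  assumes "0 \<le> x" "of_int x \<le> u" "nearest_int_dist (of_int x * \<beta>) \<le> v"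
  shows "nearest_int_dist (\<beta> * of_int x ^ Suc n) \<le> u ^ n * v"
proof -
  have "\<bar>of_int (x ^ n)\<bar> \<le> u ^ n" using assms(1,2) by (simp add: power_mono)
  from nearest_int_dist_scaled[OF this assms(3)] show ?thesis by (simp add: mult_ac)
qed

text \<open>An approximation of \<open>c \<beta>\<close> with denominator \<open>q\<close> makes the
  power small at \<open>q c\<close>: the other \<open>n\<close> factors enlarge the error by at most
  X^n, which the Y^(n+1) in \<open>approx\<close> covers, and \<open>t\<close> pays for
  \<open>c\<close>. Two lengths occur because the denominators may be bounded in terms of X^\<tau>
  while the range is \<open>Y\<close>.\<close>

lemma small_power_value:
  fixes \<beta> X t H :: real and c q :: int
  assumes q: "1 \<le> q" "of_int q \<le> X / t" and c: "1 \<le> c" "of_int c < t" and t: "0 < t" and Y: "0 < X" "X \<le> Y" and H: "H > 0"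
    and approx: "nearest_int_dist (of_int q * (of_int c * \<beta>)) \<le> X / t / (H * Y ^ Suc n)"
  shows "0 < q * c" "of_int (q * c) \<le> Y" "nearest_int_dist (\<beta> * of_int (q * c) ^ Suc n) < 1 / H"
proof -
  have le: "of_int (q * c) \<le> X / t * of_int c"
    using q c mult_right_mono[of "real_of_int q" "X / t" "of_int c"] by simp
  also have "\<dots> = X * (of_int c / t)" by simp
  also have "\<dots> \<le> X * 1" using c t Y by (intro mult_left_mono) auto
  finally have leX: "of_int (q * c) \<le> X" by simp
  with Y show "of_int (q * c) \<le> Y" by simp
  show "0 < q * c" using q c by simp
  have "nearest_int_dist (\<beta> * of_int (q * c) ^ Suc n) \<le> X ^ n * (X / t / (H * Y ^ Suc n))"
    using leX approx \<open>0 < q * c\<close> by (intro nearest_int_dist_power_le) (auto simp: mult.assoc)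
  also have "\<dots> = (X ^ Suc n / Y ^ Suc n) * (1 / t) / H" by (simp add: mult_ac)
  also have "\<dots> \<le> 1 * (1 / t) / H"
    using Y t H by (intro divide_right_mono mult_right_mono) (auto intro!: power_mono mult_mono simp: divide_le_eq)
  also have "\<dots> < 1 / H"
  proof -
    have "t > 1" using c by linarith
    thus ?thesis using H by (intro divide_strict_right_mono) auto
  qed
  finally show "nearest_int_dist (\<beta> * of_int (q * c) ^ Suc n) < 1 / H" .
qed

lemma gap_form_Suc_scale:
  assumes "i + 3 \<le> k"
  shows "gap_form k (Suc i) \<alpha> x (Q * y) = gap_form k i (\<lambda>m. if m = k then \<alpha> k else \<alpha> m * of_int Q ^ (k - m)) x y
    + \<alpha> (Suc i) * of_int x ^ Suc i * of_int (Q * y) ^ (k - Suc i)"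
proof -
  have "(\<Sum>m=0..i. \<alpha> m * of_int x ^ m * of_int (Q * y) ^ (k - m))
      = (\<Sum>m=0..i. (if m = k then \<alpha> k else \<alpha> m * of_int Q ^ (k - m)) * of_int x ^ m * of_int y ^ (k - m))"
    using assms by (intro sum.cong) (auto simp: power_mult_distrib)
  thus ?thesis unfolding gap_form_def by simp
qed

text \<open>One factor of (Q y)^(n+1) is spent on \<open>Q \<beta>\<close>, which is close to an
  integer. The remaining integer is at most X^j s^n (Y/s)^(n+1) = X^j Y^(n+1) / s, and this 1/s
  cancels the \<open>s\<close> in the approximation error.\<close>

lemma remainder_term_small:
  fixes \<beta> X Y t H s :: real and Q x y :: int
  assumes x: "0 \<le> x" "of_int x \<le> X" and y: "0 \<le> y" "of_int y \<le> Y / s" and Q: "0 \<le> Q" "of_int Q \<le> s * (c / t)"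
    and c: "0 \<le> c" "c \<le> t" and t: "2 \<le> t" and s: "0 < s" and pos: "X > 0" "Y > 0" "H > 0"
    and approx: "nearest_int_dist (of_int Q * \<beta>) \<le> s / t / (H * (X ^ j * Y ^ Suc n))"
  shows "nearest_int_dist (\<beta> * of_int x ^ j * of_int (Q * y) ^ Suc n) \<le> 1 / (2 * H)"
proof -
  have "of_int Q \<le> s * 1"
    using Q(2) c t s by (elim order_trans) (intro mult_left_mono, auto)
  hence Qs: "real_of_int Q \<le> s" by simp
  have "\<bar>of_int (x ^ j * (Q ^ n * y ^ Suc n))\<bar> = real_of_int x ^ j * (real_of_int Q ^ n * real_of_int y ^ Suc n)"
    using x Q y by (simp add: abs_mult)
  also have "\<dots> \<le> X ^ j * (s ^ n * (Y / s) ^ Suc n)"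
    using x y Q Qs pos s by (intro mult_mono power_mono) auto
  also have "\<dots> = X ^ j * Y ^ Suc n / s" using s by (simp add: power_divide)
  finally have bd: "\<bar>of_int (x ^ j * (Q ^ n * y ^ Suc n))\<bar> \<le> X ^ j * Y ^ Suc n / s" .
  have "\<beta> * of_int x ^ j * of_int (Q * y) ^ Suc n = of_int (x ^ j * (Q ^ n * y ^ Suc n)) * (of_int Q * \<beta>)"
    by (simp add: power_mult_distrib mult_ac)
  also have "nearest_int_dist \<dots> \<le> (X ^ j * Y ^ Suc n / s) * (s / t / (H * (X ^ j * Y ^ Suc n)))"
    by (rule nearest_int_dist_scaled[OF bd approx])
  also have "\<dots> = 1 / (t * H)"
  proof -
    define R where "R = X ^ j * Y ^ Suc n"
    have "R > 0" using pos by (simp add: R_def)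
    thus ?thesis unfolding R_def[symmetric] using s by simp
  qed
  also have "\<dots> \<le> 1 / (2 * H)" using t pos by (intro divide_left_mono mult_right_mono) auto
  finally show ?thesis .
qed

lemma box_size_lower:
  fixes N H :: nat and X :: real
  assumes "X \<ge> 2" and N: "N = nat \<lfloor>X\<rfloor>"
  shows "1 \<le> N" "real N \<le> X" "X / 2 \<le> real N" "X \<le> real (2 * N + 1)" "X \<le> 2 * real N"
proof -
  have "real N = of_int \<lfloor>X\<rfloor>" using assms by simp
  hence "real N \<le> X" "X < real N + 1" by linarith+
  thus "real N \<le> X" "X / 2 \<le> real N" "X \<le> real (2 * N + 1)" "X \<le> 2 * real N" "1 \<le> N"
    using assms(1) by auto
qed

text \<open>For \<open>Z1 = X / t\<close> and \<open>Z2 = X^\<tau> / t\<close> the conclusion of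
  \<open>gap_form_step\<close> fails, so one of its separation premises must fail. A good
  approximation for \<alpha>_k already yields a solution with \<open>y = 0\<close>, hence only the
  one for \<alpha>_j is left as an alternative. \<open>B\<close> is any constant that the caller
  wants dominated by X^(\<delta>/4).\<close>

lemma gap_form_alternative:
  fixes k j :: nat and \<tau> \<delta> B :: real
  assumes jk: "j + 2 \<le> k" and \<tau>: "0 < \<tau>" "\<tau> \<le> 1" and \<delta>: "0 < \<delta>" "\<delta> \<le> \<tau>"
  obtains X0 :: real where "\<And>X Y (H::nat) \<alpha>. X0 \<le> X \<Longrightarrow> X powr \<tau> \<le> Y \<Longrightarrow> Y \<le> X \<Longrightarrow> 1 \<le> H \<Longrightarrow>
    real H ^ (2 ^ (k - 1)) \<le> X powr (1 + \<tau> - \<delta>) \<Longrightarrow>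
    1 \<le> X \<and> B < X powr (\<delta> / 4) \<and>
    ((\<exists>x y. 0 \<le> x \<and> of_int x \<le> X \<and> 0 \<le> y \<and> of_int y \<le> Y \<and> (x, y) \<noteq> (0, 0)
        \<and> nearest_int_dist (gap_form k j \<alpha> x y) < 1 / real H)
     \<or> (\<exists>q::int. 1 \<le> q \<and> of_int q \<le> X powr \<tau> / X powr (\<delta> / 4)
        \<and> nearest_int_dist (of_int q * (fact j * fact (k - j) * \<alpha> j)) \<le> X powr \<tau> / X powr (\<delta> / 4) / (real H * (X ^ j * Y ^ (k - j)))))"
proof -
  define n where "n = k - j - 1"
  have n: "k = j + n + 1" "k - j = Suc n" "k - 1 = j + n" using jk by (auto simp: n_def)
  \<comment> \<open>\<open>M1\<close> and \<open>M2\<close> will be at most X^(2k), so each of their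
    powers costs at most X^(\<delta>/8).\<close>
  define \<epsilon> where "\<epsilon> = \<delta> / (16 * real k)"
  have "\<epsilon> > 0" using \<delta> jk by (simp add: \<epsilon>_def)
  obtain C where C: "C > 0"
    "\<And>N P H Z1 Z2 \<alpha> M1 M2. N \<ge> 1 \<Longrightarrow> P \<ge> 1 \<Longrightarrow> H \<ge> 1 \<Longrightarrow>
      M1 = 2 * H * (2 * N + 1) ^ (k - 1) \<Longrightarrow> M2 = 2 * H * (2 * N + 1) ^ j * (2 * P + 1) ^ (k - j - 1) \<Longrightarrow>
      P \<le> N \<Longrightarrow> 1 \<le> Z1 \<Longrightarrow> Z1 \<le> real N \<Longrightarrow> 1 \<le> Z2 \<Longrightarrow> Z2 \<le> real P \<Longrightarrow>
      (\<And>q::int. 1 \<le> q \<Longrightarrow> of_int q \<le> Z1 \<Longrightarrow> Z1 / (real M1 * real N) < nearest_int_dist (of_int q * (fact k * \<alpha> k))) \<Longrightarrow>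
      (\<And>q::int. 1 \<le> q \<Longrightarrow> of_int q \<le> Z2 \<Longrightarrow> Z2 / (real M2 * real P) < nearest_int_dist (of_int q * (fact j * fact (k - j) * \<alpha> j))) \<Longrightarrow>
      (\<And>x y. x \<in> {1..int N} \<Longrightarrow> y \<in> {1..int P} \<Longrightarrow> 1 / real H \<le> nearest_int_dist (gap_form k j \<alpha> x y)) \<Longrightarrow>
      Z1 * Z2 \<le> C * (real M1 powr \<epsilon> * real M2 powr \<epsilon>) * real H ^ (2 ^ (k - 1))"
    using gap_form_step[OF \<open>\<epsilon> > 0\<close> jk] by metis
  define E where "E = max (max B C) (max 2 (fact k)) + 1"
  define X0 where "X0 = max (2 * 3 ^ k) (E powr (4 / \<delta>))"
  show ?thesis
  proof (rule that[of X0])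
    fix X Y :: real and H :: nat and \<alpha> :: "nat \<Rightarrow> real"
    assume X: "X0 \<le> X" and Y: "X powr \<tau> \<le> Y" "Y \<le> X" and H: "1 \<le> H"
      and HK: "real H ^ (2 ^ (k - 1)) \<le> X powr (1 + \<tau> - \<delta>)"
    define t where "t = X powr (\<delta> / 4)"
    define Z1 where "Z1 = X / t"
    define Z2 where "Z2 = X powr \<tau> / t"
    have X3: "2 * 3 ^ k \<le> X" and XE: "E powr (4 / \<delta>) \<le> X" using X by (simp_all add: X0_def)
    have X2: "2 \<le> X" using X3 one_le_power[of "3::real" k] by linarith
    have "E \<ge> 3" by (simp add: E_def)
    hence "E = (E powr (4 / \<delta>)) powr (\<delta> / 4)" using \<delta> by (simp add: powr_powr)
    also have "\<dots> \<le> t" unfolding t_def using \<delta> XE by (intro powr_mono2) auto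
    finally have tE: "E \<le> t" .
    have t: "B < t" "C < t" "2 \<le> t" "fact k < t" using tE by (auto simp: E_def max_def split: if_splits)
    have "X powr (\<delta> / 4) \<le> X powr \<tau>" using X2 \<delta> by (intro powr_mono) auto
    hence Z2_1: "1 \<le> Z2" using t unfolding Z2_def t_def[symmetric] by simp
    have "X powr \<tau> \<le> X powr 1" using X2 \<tau> by (intro powr_mono) auto
    hence "Z2 \<le> Z1" using X2 t by (simp add: Z1_def Z2_def divide_right_mono)
    have Y2: "2 \<le> Y"
    proof -
      have "t \<le> X powr \<tau>" unfolding t_def by fact
      thus ?thesis using t Y by linarith
    qed
    define N where "N = nat \<lfloor>X\<rfloor>"
    define P where "P = nat \<lfloor>Y\<rfloor>"
    note N = box_size_lower[OF X2 N_def] and P = box_size_lower[OF Y2 P_def]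
    have PN: "P \<le> N" unfolding P_def N_def using Y by (intro nat_mono floor_mono)
    have Z2P: "Z2 \<le> real P"
    proof -
      have "Z2 \<le> X powr \<tau> / 2" unfolding Z2_def using t by (intro divide_left_mono) auto
      thus ?thesis using Y P(3) by linarith
    qed
    have Z1N: "Z1 \<le> real N"
    proof -
      have "Z1 \<le> X / 2" unfolding Z1_def using t X2 by (intro divide_left_mono) auto
      thus ?thesis using N(3) by linarith
    qed
    define M1 where "M1 = 2 * H * (2 * N + 1) ^ (k - 1)"
    define M2 where "M2 = 2 * H * (2 * N + 1) ^ j * (2 * P + 1) ^ (k - j - 1)"
    have M1N: "real H * X ^ k \<le> real M1 * real N"
    proof -
      have "real H * X ^ (j + n) * X \<le> real H * real (2 * N + 1) ^ (j + n) * (2 * real N)"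
        using N X2 by (intro mult_mono power_mono mult_nonneg_nonneg) auto
      thus ?thesis by (simp add: M1_def n mult_ac)
    qed
    have M2P: "real H * (X ^ j * Y ^ (k - j)) \<le> real M2 * real P"
    proof -
      have "real H * X ^ j * Y ^ n * Y \<le> real H * real (2 * N + 1) ^ j * real (2 * P + 1) ^ n * (2 * real P)"
        using N P X2 Y2 by (intro mult_mono power_mono mult_nonneg_nonneg) auto
      thus ?thesis by (simp add: M2_def n mult_ac)
    qed
    have HX: "real H \<le> X"
    proof -
      have "(2::nat) ^ 1 \<le> 2 ^ (k - 1)" using jk by (intro power_increasing) auto
      have "X powr (1 + \<tau> - \<delta>) \<le> X powr 2" using X2 \<tau> \<delta> by (intro powr_mono) auto
      also have "\<dots> = X ^ 2" using X2 by (simp add: powr_numeral)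
      also have "\<dots> \<le> X ^ (2 ^ (k - 1))" using X2 \<open>(2::nat) ^ 1 \<le> 2 ^ (k - 1)\<close> by (intro power_increasing) auto
      finally have "real H ^ (2 ^ (k - 1)) \<le> X ^ (2 ^ (k - 1))" using HK by linarith
      thus ?thesis using X2 by (auto simp: power_mono_iff)
    qed
    have M_le: "real M powr \<epsilon> \<le> X powr (\<delta> / 8)" if "real M \<le> 2 * real H * (3 * X) ^ (k - 1)" for M :: nat
    proof -
      have "2 * real H * (3 * X) ^ (k - 1) \<le> 2 * X * (3 * X) ^ (k - 1)"
        using HX X2 by (intro mult_right_mono) auto
      also have "\<dots> = 2 * 3 ^ (k - 1) * (X * X ^ (k - 1))" by (simp add: power_mult_distrib)
      also have "X * X ^ (k - 1) = X ^ k" using jk by (cases k) auto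
      also have "2 * 3 ^ (k - 1) * X ^ k \<le> X * X ^ k"
      proof (intro mult_right_mono)
        have "(3::real) ^ (k - 1) \<le> 3 ^ k" by (intro power_increasing) auto
        thus "2 * 3 ^ (k - 1) \<le> X" using X3 by linarith
      qed (use X2 in auto)
      also have "\<dots> = X ^ (k + 1)" by simp
      also have "\<dots> \<le> X ^ (2 * k)" using X2 jk by (intro power_increasing) auto
      also have "\<dots> = X powr (2 * real k)" using X2 by (simp add: powr_realpow[symmetric])
      finally have "real M powr \<epsilon> \<le> (X powr (2 * real k)) powr \<epsilon>"
        using that \<open>\<epsilon> > 0\<close> by (intro powr_mono2) auto
      also have "\<dots> = X powr (\<delta> / 8)" using jk by (simp add: powr_powr \<epsilon>_def)
      finally show ?thesis .
    qed
    have N3: "real (2 * N + 1) \<le> 3 * X" "real (2 * P + 1) \<le> 3 * X" using N P Y X2 by auto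
    have M1_le: "real M1 powr \<epsilon> \<le> X powr (\<delta> / 8)"
    proof (rule M_le)
      have "2 * real H * real (2 * N + 1) ^ (k - 1) \<le> 2 * real H * (3 * X) ^ (k - 1)"
        using N3 by (intro mult_left_mono power_mono) auto
      thus "real M1 \<le> 2 * real H * (3 * X) ^ (k - 1)" by (simp add: M1_def)
    qed
    have M2_le: "real M2 powr \<epsilon> \<le> X powr (\<delta> / 8)"
    proof (rule M_le)
      have "2 * real H * (real (2 * N + 1) ^ j * real (2 * P + 1) ^ n) \<le> 2 * real H * ((3 * X) ^ j * (3 * X) ^ n)"
        using N3 X2 by (intro mult_left_mono mult_mono power_mono) auto
      thus "real M2 \<le> 2 * real H * (3 * X) ^ (k - 1)" by (simp add: M2_def n power_add mult.assoc)
    qed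
    let ?sol = "\<exists>x y. 0 \<le> x \<and> of_int x \<le> X \<and> 0 \<le> y \<and> of_int y \<le> Y \<and> (x, y) \<noteq> (0, 0)
        \<and> nearest_int_dist (gap_form k j \<alpha> x y) < 1 / real H"
    let ?app = "\<exists>q::int. 1 \<le> q \<and> of_int q \<le> Z2
        \<and> nearest_int_dist (of_int q * (fact j * fact (k - j) * \<alpha> j)) \<le> Z2 / (real H * (X ^ j * Y ^ (k - j)))"
    have "?sol \<or> ?app"
    proof (rule ccontr)
      assume "\<not> (?sol \<or> ?app)"
      hence nosol: "\<not> ?sol" and noapp: "\<not> ?app" by auto
      have far2: "Z2 / (real M2 * real P) < nearest_int_dist (of_int q * (fact j * fact (k - j) * \<alpha> j))"
        if "1 \<le> q" "of_int q \<le> Z2" for q :: int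
      proof -
        have "Z2 / (real M2 * real P) \<le> Z2 / (real H * (X ^ j * Y ^ (k - j)))"
          using M2P Z2_1 H X2 Y2 by (intro divide_left_mono mult_pos_pos zero_less_power) (use P(1) in \<open>auto simp: M2_def\<close>)
        thus ?thesis using noapp that by (meson linorder_not_le order_trans)
      qed
      have far1: "Z1 / (real M1 * real N) < nearest_int_dist (of_int q * (fact k * \<alpha> k))"
        if q: "1 \<le> q" "of_int q \<le> Z1" for q :: int
      proof (rule ccontr)
        assume "\<not> ?thesis"
        hence "nearest_int_dist (of_int q * (of_int (fact k) * \<alpha> k)) \<le> Z1 / (real M1 * real N)" by simp
        also have "\<dots> \<le> X / t / (real H * X ^ Suc (k - 1))"
          unfolding Z1_def using M1N H X2 t jk N(1) by (intro divide_left_mono mult_pos_pos) (auto simp: M1_def)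
        finally have "nearest_int_dist (of_int q * (of_int (fact k) * \<alpha> k)) \<le> X / t / (real H * X ^ Suc (k - 1))" .
        note small = small_power_value[OF q(1) q(2)[unfolded Z1_def] _ _ _ _ order_refl _ this]
        have "of_int (fact k) < t" using t by simp
        hence v: "0 < q * fact k" "of_int (q * fact k) \<le> X" "nearest_int_dist (\<alpha> k * of_int (q * fact k) ^ k) < 1 / real H"
          using small t X2 H jk by (auto simp del: of_int_mult power_Suc)
        have "gap_form k j \<alpha> (q * fact k) 0 = \<alpha> k * of_int (q * fact k) ^ k"
          unfolding gap_form_def using jk by (auto intro!: sum.neutral)
        hence ?sol using v Y2 by - (rule exI[of _ "q * fact k"], rule exI[of _ "0::int"], use q in simp)
        with nosol show False by contradiction
      qed
      have gap: "1 / real H \<le> nearest_int_dist (gap_form k j \<alpha> x y)" if "x \<in> {1..int N}" "y \<in> {1..int P}" for x y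
      proof -
        have "real_of_int x \<le> real N" "real_of_int y \<le> real P" using that by auto
        hence "0 \<le> x" "of_int x \<le> X" "0 \<le> y" "of_int y \<le> Y" "(x, y) \<noteq> (0, 0)" using that N(2) P(2) by auto
        with nosol show ?thesis by (meson linorder_not_le)
      qed
      have "Z1 * Z2 \<le> C * (real M1 powr \<epsilon> * real M2 powr \<epsilon>) * real H ^ (2 ^ (k - 1))"
        by (rule C(2)[OF N(1) P(1) H M1_def M2_def PN order_trans[OF Z2_1 \<open>Z2 \<le> Z1\<close>] Z1N Z2_1 Z2P far1 far2 gap])
      also have "\<dots> \<le> C * (X powr (\<delta> / 8) * X powr (\<delta> / 8)) * X powr (1 + \<tau> - \<delta>)"
        using C(1) by (intro mult_mono M1_le M2_le HK) auto
      also have "\<dots> = C * X powr (1 + \<tau> - 3 / 4 * \<delta>)"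
        by (simp add: powr_add[symmetric] mult.assoc)
      \<comment> \<open>The product is X^(1 + \<tau> - \<delta>/2). It exceeds the power of
        \<open>X\<close> in the upper bound by a factor \<open>t\<close>, and \<open>t > C\<close>
        gives the contradiction.\<close>
      also have "Z1 * Z2 = t * X powr (1 + \<tau> - 3 / 4 * \<delta>)"
      proof -
        have "Z1 * Z2 * (t * t) = X powr 1 * X powr \<tau>" using t X2 by (simp add: Z1_def Z2_def)
        also have "\<dots> = t * X powr (1 + \<tau> - 3 / 4 * \<delta>) * (t * t)"
          unfolding t_def powr_add[symmetric] by (intro arg_cong2[where f = "(powr)"]) auto
        finally show ?thesis using t by simp
      qed
      finally show False using t X2 by simp
    qed
    thus "1 \<le> X \<and> B < X powr (\<delta> / 4) \<and> (?sol
       \<or> (\<exists>q::int. 1 \<le> q \<and> of_int q \<le> X powr \<tau> / X powr (\<delta> / 4)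
        \<and> nearest_int_dist (of_int q * (fact j * fact (k - j) * \<alpha> j)) \<le> X powr \<tau> / X powr (\<delta> / 4) / (real H * (X ^ j * Y ^ (k - j)))))"
      using t(1) X2 unfolding Z2_def t_def by (intro conjI) auto
  qed
qed

text \<open>The lower bound for \<open>Y\<close> allows division by X^\<tau> in each of
  \<open>j\<close> descents and still leaves X^\<tau> when \<open>j = 0\<close>. The induction must
  vary \<open>\<delta>\<close>, since each descent halves it to pay for doubling
  \<open>H\<close>.\<close>

lemma gap_form_small_value:
  fixes k j :: nat and \<tau> \<delta> :: real
  assumes "j + 2 \<le> k" "0 < \<tau>" "\<tau> \<le> 1" "0 < \<delta>" "\<delta> \<le> \<tau>"
  shows "\<exists>X0. \<forall>X Y. \<forall>H::nat. \<forall>\<alpha>. X0 \<le> X \<longrightarrow> X powr ((real j + 1) * \<tau>) \<le> Y \<longrightarrow> Y \<le> X \<longrightarrow> 1 \<le> H \<longrightarrow>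
    real H ^ (2 ^ (k - 1)) \<le> X powr (1 + \<tau> - \<delta>) \<longrightarrow>
    (\<exists>x y. 0 \<le> x \<and> of_int x \<le> X \<and> 0 \<le> y \<and> of_int y \<le> Y \<and> (x, y) \<noteq> (0, 0)
      \<and> nearest_int_dist (gap_form k j \<alpha> x y) < 1 / real H)"
  using assms
proof (induction j arbitrary: \<delta>)
  case 0
  have jk: "0 + 2 \<le> k" using 0 by simp
  show ?case
  proof (rule gap_form_alternative[OF jk 0(2,3,4,5), of "fact k"])
    fix X0 :: real
    assume alt: "\<And>X Y (H::nat) \<alpha>. X0 \<le> X \<Longrightarrow> X powr \<tau> \<le> Y \<Longrightarrow> Y \<le> X \<Longrightarrow> 1 \<le> H \<Longrightarrow>
      real H ^ (2 ^ (k - 1)) \<le> X powr (1 + \<tau> - \<delta>) \<Longrightarrow>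
      1 \<le> X \<and> fact k < X powr (\<delta> / 4) \<and>
      ((\<exists>x y. 0 \<le> x \<and> of_int x \<le> X \<and> 0 \<le> y \<and> of_int y \<le> Y \<and> (x, y) \<noteq> (0, 0)
          \<and> nearest_int_dist (gap_form k 0 \<alpha> x y) < 1 / real H)
       \<or> (\<exists>q::int. 1 \<le> q \<and> of_int q \<le> X powr \<tau> / X powr (\<delta> / 4)
          \<and> nearest_int_dist (of_int q * (fact 0 * fact (k - 0) * \<alpha> 0)) \<le> X powr \<tau> / X powr (\<delta> / 4) / (real H * (X ^ 0 * Y ^ (k - 0)))))"
    show ?thesis
    proof (intro exI[of _ X0] allI impI)
      fix X Y :: real and H :: nat and \<alpha> :: "nat \<Rightarrow> real"
      assume X: "X0 \<le> X" and Y: "X powr ((real 0 + 1) * \<tau>) \<le> Y" "Y \<le> X" and H: "1 \<le> H"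
        and HK: "real H ^ (2 ^ (k - 1)) \<le> X powr (1 + \<tau> - \<delta>)"
      let ?sol = "\<exists>x y. 0 \<le> x \<and> of_int x \<le> X \<and> 0 \<le> y \<and> of_int y \<le> Y \<and> (x, y) \<noteq> (0, 0)
        \<and> nearest_int_dist (gap_form k 0 \<alpha> x y) < 1 / real H"
      define t where "t = X powr (\<delta> / 4)"
      have Y1: "X powr \<tau> \<le> Y" using Y by simp
      note A = alt[OF X Y1 Y(2) H HK, of \<alpha>]
      have X1: "1 \<le> X" and t: "fact k < t" using A by (auto simp: t_def)
      from A consider ?sol | q :: int where "1 \<le> q" "of_int q \<le> X powr \<tau> / t"
        "nearest_int_dist (of_int q * (of_int (fact k) * \<alpha> 0)) \<le> X powr \<tau> / t / (real H * Y ^ Suc (k - 1))"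
        using jk by (auto simp: t_def)
      thus ?sol
      proof cases
        case 2
        have t0: "0 < t" using t X1 by (simp add: t_def)
        note small = small_power_value[OF 2(1,2) _ _ t0 _ Y1 _ 2(3)]
        have v: "0 < q * fact k" "of_int (q * fact k) \<le> Y" "nearest_int_dist (\<alpha> 0 * of_int (q * fact k) ^ k) < 1 / real H"
          using small t X1 H jk by (auto simp del: of_int_mult power_Suc)
        have "gap_form k 0 \<alpha> 0 (q * fact k) = \<alpha> 0 * of_int (q * fact k) ^ k"
          unfolding gap_form_def using jk by simp
        with v X1 show ?thesis by - (rule exI[of _ "0::int"], rule exI[of _ "q * fact k"], use 2(1) in simp)
      qed
    qed
  qed
next
  case (Suc i)
  let ?j = "Suc i"
  define n where "n = k - ?j - 1"
  have n: "k - ?j = Suc n" and ik: "i + 2 \<le> k" "i + 3 \<le> k" using Suc.prems by (auto simp: n_def)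
  have \<delta>2: "0 < \<delta> / 2" "\<delta> / 2 \<le> \<tau>" using Suc.prems by auto
  obtain X1 where IH: "\<And>X Y (H::nat) \<alpha>. X1 \<le> X \<Longrightarrow> X powr ((real i + 1) * \<tau>) \<le> Y \<Longrightarrow> Y \<le> X \<Longrightarrow> 1 \<le> H \<Longrightarrow>
    real H ^ (2 ^ (k - 1)) \<le> X powr (1 + \<tau> - \<delta> / 2) \<Longrightarrow>
    (\<exists>x y. 0 \<le> x \<and> of_int x \<le> X \<and> 0 \<le> y \<and> of_int y \<le> Y \<and> (x, y) \<noteq> (0, 0)
      \<and> nearest_int_dist (gap_form k i \<alpha> x y) < 1 / real H)"
    using Suc.IH[OF ik(1) Suc.prems(2,3) \<delta>2] by metis
  define c :: int where "c = fact ?j * fact (k - ?j)"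
  have c1: "c \<ge> 1" unfolding c_def by (metis fact_ge_1 mult_mono' mult_1 zero_le_one)
  \<comment> \<open>\<open>of_int c\<close> allows for the factorials contained in
    \<open>Q = q * c\<close>; the last entry is the factor that arises when \<open>H\<close> is
    replaced by \<open>2 * H\<close>.\<close>
  define B where "B = max 2 (max (of_int c) (2 ^ (2 ^ (k - 1))) :: real)"
  show ?case
  proof (rule gap_form_alternative[OF Suc.prems, of B])
    fix X0 :: real
    assume alt: "\<And>X Y (H::nat) \<alpha>. X0 \<le> X \<Longrightarrow> X powr \<tau> \<le> Y \<Longrightarrow> Y \<le> X \<Longrightarrow> 1 \<le> H \<Longrightarrow>
      real H ^ (2 ^ (k - 1)) \<le> X powr (1 + \<tau> - \<delta>) \<Longrightarrow>
      1 \<le> X \<and> B < X powr (\<delta> / 4) \<and>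
      ((\<exists>x y. 0 \<le> x \<and> of_int x \<le> X \<and> 0 \<le> y \<and> of_int y \<le> Y \<and> (x, y) \<noteq> (0, 0)
          \<and> nearest_int_dist (gap_form k ?j \<alpha> x y) < 1 / real H)
       \<or> (\<exists>q::int. 1 \<le> q \<and> of_int q \<le> X powr \<tau> / X powr (\<delta> / 4)
          \<and> nearest_int_dist (of_int q * (fact ?j * fact (k - ?j) * \<alpha> ?j)) \<le> X powr \<tau> / X powr (\<delta> / 4) / (real H * (X ^ ?j * Y ^ (k - ?j)))))"
    show ?thesis
    proof (intro exI[of _ "max 1 (max X0 X1)"] allI impI)
      fix X Y :: real and H :: nat and \<alpha> :: "nat \<Rightarrow> real"
      assume X: "max 1 (max X0 X1) \<le> X" and Y: "X powr ((real ?j + 1) * \<tau>) \<le> Y" "Y \<le> X" and H: "1 \<le> H"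
        and HK: "real H ^ (2 ^ (k - 1)) \<le> X powr (1 + \<tau> - \<delta>)"
      let ?sol = "\<exists>x y. 0 \<le> x \<and> of_int x \<le> X \<and> 0 \<le> y \<and> of_int y \<le> Y \<and> (x, y) \<noteq> (0, 0)
        \<and> nearest_int_dist (gap_form k ?j \<alpha> x y) < 1 / real H"
      define t where "t = X powr (\<delta> / 4)"
      define s where "s = X powr \<tau>"
      have XX: "1 \<le> X" "X0 \<le> X" "X1 \<le> X" using X by auto
      have s0: "0 < s" using XX by (simp add: s_def)
      have "X powr (1 * \<tau>) \<le> X powr ((real ?j + 1) * \<tau>)"
        using XX Suc.prems by (intro powr_mono mult_right_mono) auto
      hence sY: "s \<le> Y" using Y by (simp add: s_def)
      hence Y0: "0 < Y" using s0 by simp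
      note A = alt[OF XX(2) sY[unfolded s_def] Y(2) H HK, of \<alpha>]
      have t: "2 \<le> t" "of_int c \<le> t" "2 ^ (2 ^ (k - 1)) \<le> t" using A by (auto simp: t_def B_def)
      from A consider ?sol | q :: int where "1 \<le> q" "of_int q \<le> s / t"
        "nearest_int_dist (of_int q * (of_int c * \<alpha> ?j)) \<le> s / t / (real H * (X ^ ?j * Y ^ Suc n))"
        unfolding t_def[symmetric] s_def[symmetric] n c_def by auto
      thus ?sol
      proof cases
        case 2
        define Q where "Q = q * c"
        have Q: "0 < Q" using 2(1) c1 by (simp add: Q_def)
        have "of_int Q \<le> s / t * of_int c"
          using 2(2) c1 unfolding Q_def of_int_mult by (intro mult_right_mono) auto
        hence Qc: "of_int Q \<le> s * (of_int c / t)" by simp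
        also have "\<dots> \<le> s * 1" using t s0 by (intro mult_left_mono) auto
        finally have Qs: "of_int Q \<le> s" by simp
        \<comment> \<open>Replacing \<open>y\<close> by \<open>Q * y\<close> and dropping the term
          of index \<open>Suc i\<close> leaves a form of the same kind, with powers of
          \<open>Q\<close> absorbed into its coefficients.\<close>
        define \<alpha>' where "\<alpha>' m = (if m = k then \<alpha> k else \<alpha> m * of_int Q ^ (k - m))" for m
        have "X powr ((real i + 1) * \<tau>) * s \<le> Y"
          using Y(1) by (simp add: s_def powr_add[symmetric] algebra_simps)
        hence Y1: "X powr ((real i + 1) * \<tau>) \<le> Y / s" using s0 by (simp add: le_divide_eq)
        have "1 \<le> s" using XX Suc.prems unfolding s_def by (intro ge_one_powr_ge_zero) auto
        hence "Y / s \<le> Y / 1" using Y0 by (intro divide_left_mono) auto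
        hence Y2: "Y / s \<le> X" using Y(2) by simp
        \<comment> \<open>The smaller form has to come within \<open>1 / (2 * H)\<close>, because
          the dropped term may use up the other half of \<open>1 / H\<close>.\<close>
        have "real (2 * H) ^ (2 ^ (k - 1)) = 2 ^ (2 ^ (k - 1)) * real H ^ (2 ^ (k - 1))"
          by (simp add: power_mult_distrib)
        also have "\<dots> \<le> t * X powr (1 + \<tau> - \<delta>)" using t HK by (intro mult_mono) auto
        also have "\<dots> = X powr (1 + \<tau> - 3 / 4 * \<delta>)" by (simp add: t_def powr_add[symmetric] algebra_simps)
        also have "\<dots> \<le> X powr (1 + \<tau> - \<delta> / 2)" using XX Suc.prems by (intro powr_mono) auto
        finally have HK': "real (2 * H) ^ (2 ^ (k - 1)) \<le> X powr (1 + \<tau> - \<delta> / 2)" .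
        have "1 \<le> 2 * H" using H by simp
        from IH[OF XX(3) Y1 Y2 this HK', of \<alpha>'] obtain x y
          where xy: "0 \<le> x" "of_int x \<le> X" "0 \<le> y" "of_int y \<le> Y / s" "(x, y) \<noteq> (0, 0)"
            "nearest_int_dist (gap_form k i \<alpha>' x y) < 1 / real (2 * H)" by blast
        have approx: "nearest_int_dist (of_int Q * \<alpha> ?j) \<le> s / t / (real H * (X ^ ?j * Y ^ Suc n))"
          using 2(3) by (simp add: Q_def mult.assoc)
        have rem: "nearest_int_dist (\<alpha> ?j * of_int x ^ ?j * of_int (Q * y) ^ Suc n) \<le> 1 / (2 * real H)"
          by (rule remainder_term_small[OF xy(1,2,3,4) _ Qc _ t(2,1) s0 _ Y0 _ approx]) (use Q c1 XX H in auto)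
        have "nearest_int_dist (gap_form k ?j \<alpha> x (Q * y))
            \<le> nearest_int_dist (gap_form k i \<alpha>' x y) + nearest_int_dist (\<alpha> ?j * of_int x ^ ?j * of_int (Q * y) ^ Suc n)"
          unfolding gap_form_Suc_scale[OF ik(2)] n \<alpha>'_def[symmetric] by (rule nearest_int_dist_triangle)
        also have "\<dots> < 1 / real (2 * H) + 1 / (2 * real H)" using xy(6) rem by (rule add_less_le_mono)
        also have "\<dots> = 1 / real H" by simp
        finally have "nearest_int_dist (gap_form k ?j \<alpha> x (Q * y)) < 1 / real H" .
        moreover have "of_int (Q * y) \<le> Y"
        proof -
          have "real_of_int Q * real_of_int y \<le> s * (Y / s)" using Qs xy Q s0 by (intro mult_mono) auto
          thus ?thesis using s0 by simp
        qed
        moreover have "(x, Q * y) \<noteq> (0, 0)" "0 \<le> Q * y" using xy Q by auto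
        ultimately show ?thesis using xy(1,2) by blast
      qed
    qed
  qed
qed

theorem theorem1p1:
  fixes k :: nat and \<epsilon> :: real
  assumes "\<epsilon> > 0"
  shows "\<exists>X0::real. \<forall>l::nat. 1 \<le> l \<and> l + 2 \<le> k \<longrightarrow>
    (\<forall>\<alpha> :: nat \<Rightarrow> real. \<forall>X\<ge>X0.
      (MIN (x, y)\<in>box_pairs X. nearest_int_dist (gap_form k l \<alpha> x y))
        < X powr (- gap_exponent k l + \<epsilon>))"
proof -
  define K :: real where "K = 2 ^ (k - 1)"
  have "\<exists>X0. \<forall>X\<ge>X0. \<forall>\<alpha>. (MIN (x, y)\<in>box_pairs X. nearest_int_dist (gap_form k l \<alpha> x y))
        < X powr (- gap_exponent k l + \<epsilon>)" if l: "l + 2 \<le> k" for l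
  proof -
    \<comment> \<open>With \<open>Y = X\<close> the induction asks for X^((l+1) \<tau>) <= X, so
      this is the largest admissible value.\<close>
    define \<tau> where "\<tau> = 1 / (real l + 1)"
    \<comment> \<open>Passing from the exponent to \<open>\<rho>\<close> gains
      \<open>K * \<epsilon> >= 2 * \<delta>\<close>: one \<open>\<delta>\<close> absorbs the
      rounding of \<open>H\<close>, the other is demanded by
      \<open>gap_form_small_value\<close>.\<close>
    define \<delta> where "\<delta> = min \<tau> (K * \<epsilon> / 2)"
    have K1: "K \<ge> 1" by (simp add: K_def)
    have \<tau>: "0 < \<tau>" "\<tau> \<le> 1" by (auto simp: \<tau>_def)
    have \<delta>: "0 < \<delta>" "\<delta> \<le> \<tau>" using \<tau> K1 assms by (auto simp: \<delta>_def)
    have "2 powr (1 - real k) = 1 / K"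
      using l by (simp add: K_def powr_diff powr_realpow[symmetric] of_nat_diff)
    moreover have "(real l + 2) / (real l + 1) = 1 + \<tau>" by (simp add: \<tau>_def field_simps)
    ultimately have \<sigma>: "gap_exponent k l * K = 1 + \<tau>" using K1 by (simp add: gap_exponent_def)
    obtain X1 where X1: "\<And>X Y (H::nat) \<alpha>. X1 \<le> X \<Longrightarrow> X powr ((real l + 1) * \<tau>) \<le> Y \<Longrightarrow> Y \<le> X \<Longrightarrow> 1 \<le> H \<Longrightarrow>
      real H ^ (2 ^ (k - 1)) \<le> X powr (1 + \<tau> - \<delta>) \<Longrightarrow>
      (\<exists>x y. 0 \<le> x \<and> of_int x \<le> X \<and> 0 \<le> y \<and> of_int y \<le> Y \<and> (x, y) \<noteq> (0, 0)
        \<and> nearest_int_dist (gap_form k l \<alpha> x y) < 1 / real H)"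
      using gap_form_small_value[OF l \<tau> \<delta>] by metis
    show ?thesis
    proof (intro exI[of _ "max (max 1 X1) ((2 powr K) powr (1 / \<delta>))"] allI impI)
      fix X :: real and \<alpha> :: "nat \<Rightarrow> real"
      assume "max (max 1 X1) ((2 powr K) powr (1 / \<delta>)) \<le> X"
      hence X: "1 \<le> X" "X1 \<le> X" "(2 powr K) powr (1 / \<delta>) \<le> X" by auto
      define \<rho> where "\<rho> = gap_exponent k l - \<epsilon>"
      define H where "H = nat \<lceil>X powr \<rho>\<rceil>"
      have H: "X powr \<rho> \<le> real H" unfolding H_def by (rule real_nat_ceiling_ge)
      have "0 < X powr \<rho>" using X by simp
      with H have H1: "1 \<le> H" by linarith
      have "real H \<le> X powr \<rho> + 1" unfolding H_def using \<open>0 < X powr \<rho>\<close> by linarith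
      \<comment> \<open>For large \<open>\<epsilon>\<close> the exponent \<open>\<rho>\<close> is
        negative and \<open>H = 1\<close>; \<open>max 0 \<rho>\<close> treats this together with the
        main case.\<close>
      also have "\<dots> \<le> X powr (max 0 \<rho>) + X powr (max 0 \<rho>)"
        using X by (intro add_mono powr_mono ge_one_powr_ge_zero) auto
      finally have "real H \<le> 2 * X powr (max 0 \<rho>)" by simp
      hence "real H ^ (2 ^ (k - 1)) \<le> (2 * X powr (max 0 \<rho>)) ^ (2 ^ (k - 1))" by (intro power_mono) auto
      also have "\<dots> = 2 powr K * X powr (max 0 \<rho> * K)"
        using X by (simp add: K_def power_mult_distrib powr_powr[symmetric] powr_realpow[symmetric])
      also have "\<dots> \<le> X powr \<delta> * X powr (1 + \<tau> - 2 * \<delta>)"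
      proof (intro mult_mono powr_mono)
        have "2 powr K = ((2 powr K) powr (1 / \<delta>)) powr \<delta>" using \<delta> by (simp add: powr_powr)
        also have "\<dots> \<le> X powr \<delta>" using X \<delta> by (intro powr_mono2) auto
        finally show "2 powr K \<le> X powr \<delta>" .
        have "\<rho> * K = 1 + \<tau> - K * \<epsilon>" unfolding \<rho>_def left_diff_distrib \<sigma> by simp
        moreover have "\<delta> \<le> K * \<epsilon> / 2" by (simp add: \<delta>_def)
        ultimately have "\<rho> * K \<le> 1 + \<tau> - 2 * \<delta>" by linarith
        moreover have "0 \<le> 1 + \<tau> - 2 * \<delta>" using \<delta> \<tau> by linarith
        ultimately show "max 0 \<rho> * K \<le> 1 + \<tau> - 2 * \<delta>" by (simp add: max_def)
      qed (use X in auto)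
      also have "\<dots> = X powr (1 + \<tau> - \<delta>)" by (simp add: powr_add[symmetric])
      finally have HK: "real H ^ (2 ^ (k - 1)) \<le> X powr (1 + \<tau> - \<delta>)" .
      have "X powr ((real l + 1) * \<tau>) \<le> X" using X by (simp add: \<tau>_def)
      from X1[OF X(2) this order_refl H1 HK, of \<alpha>] obtain x y
        where xy: "0 \<le> x" "of_int x \<le> X" "0 \<le> y" "of_int y \<le> X" "(x, y) \<noteq> (0, 0)"
          "nearest_int_dist (gap_form k l \<alpha> x y) < 1 / real H" by blast
      have "finite (box_pairs X)"
      proof (rule finite_subset)
        show "box_pairs X \<subseteq> {0..\<lfloor>X\<rfloor>} \<times> {0..\<lfloor>X\<rfloor>}" by (auto simp: box_pairs_def le_floor_iff)
      qed simp
      moreover have "(x, y) \<in> box_pairs X" using xy by (simp add: box_pairs_def)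
      ultimately have "(MIN (x, y)\<in>box_pairs X. nearest_int_dist (gap_form k l \<alpha> x y)) \<le> nearest_int_dist (gap_form k l \<alpha> x y)"
        by (intro Min_le finite_imageI) (auto intro: image_eqI[of _ _ "(x, y)"])
      also have "\<dots> < 1 / real H" by fact
      also have "\<dots> \<le> 1 / X powr \<rho>" using H H1 X by (intro divide_left_mono mult_pos_pos) auto
      also have "\<dots> = X powr (- gap_exponent k l + \<epsilon>)" by (simp add: \<rho>_def powr_minus_divide[symmetric])
      finally show "(MIN (x, y)\<in>box_pairs X. nearest_int_dist (gap_form k l \<alpha> x y)) < X powr (- gap_exponent k l + \<epsilon>)" .
    qed
  qed
  then obtain X0 where X0: "\<And>l X \<alpha>. l + 2 \<le> k \<Longrightarrow> X0 l \<le> X \<Longrightarrow>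
      (MIN (x, y)\<in>box_pairs X. nearest_int_dist (gap_form k l \<alpha> x y)) < X powr (- gap_exponent k l + \<epsilon>)"
    by metis
  show ?thesis
  \<comment> \<open>Only finitely many \<open>l\<close> occur for a given \<open>k\<close>, so the
    largest of their thresholds is uniform in \<open>l\<close>.\<close>
  proof (intro exI[of _ "Max (X0 ` {..k})"] allI impI)
    fix l \<alpha> X assume l: "1 \<le> l \<and> l + 2 \<le> k" and "Max (X0 ` {..k}) \<le> X"
    moreover have "X0 l \<le> Max (X0 ` {..k})" using l by (intro Max_ge) auto
    ultimately show "(MIN (x, y)\<in>box_pairs X. nearest_int_dist (gap_form k l \<alpha> x y)) < X powr (- gap_exponent k l + \<epsilon>)"
      by (intro X0) auto
  qed
qed

end
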